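(* Let $(M,g)$ be an $n$-dimensional Riemannian manifold, $n\geq 3$, and let $(V,\lambda)$ define an almost Riemann soliton on $(M,g)$ with $V$ a solenoidal vector field. Then: i) $(V,\bar\lambda)$, where $\bar\lambda=\frac{n-1}{n-2}\lambda$, defines an almost $\alpha$-Ricci soliton on $(M,g)$, for $\alpha=\frac{1}{n-2}$; ii) $(\bar V,\bar\lambda)$, where $\bar V=(n-2)V$ and $\bar\lambda=(n-1)\lambda$, defines an almost Ricci soliton on $(M,g)$.
   Context: Conventions: for $(0,2)$-tensor fields, $(T_1\odot T_2)(X,Y,Z,W)=T_1(X,W)T_2(Y,Z)+T_1(Y,Z)T_2(X,W)-T_1(X,Z)T_2(Y,W)-T_1(Y,W)T_2(X,Z)$ (Kulkarni-Nomizu product). $R$ is the $(0,4)$ Riemann curvature tensor $R(X,Y,Z,W)=g(R(X,Y)Z,W)$, with $R(X,Y)Z=\nabla_X\nabla_YZ-\nabla_Y\nabla_XZ-\nabla_{[X,Y]}Z$ and $\nabla$ the Levi-Civita connection; $\operatorname{Ric}(Y,Z)$ is the trace of $X\mapsto R(X,Y)Z$. $G:=\frac12 g\odot g$. For a non-vanishing (nowhere zero) smooth vector field $V$ and a smooth function $\lambda$ on $M$: $(V,\lambda)$ defines an almost Riemann soliton if $\frac12(\pounds_Vg)\odot g+R=\lambda G$; an almost Ricci soliton if $\frac12\pounds_Vg+\operatorname{Ric}=\lambda g$; and, for a real constant $\alpha$, an almost $\alpha$-Ricci soliton if $\frac12\pounds_Vg+\alpha\operatorname{Ric}=\lambda g$.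 Here $\pounds_V$ is the Lie derivative. $V$ is solenoidal if $\operatorname{div}(V)=0$. *)

theory Defs
  imports "HOL-Analysis.Analysis" "HOL-Library.Function_Algebras"
begin

section \<open>Pointwise vector space structure on functions\<close>

instantiation "fun" :: (type, real_vector) real_vector
begin

definition scaleR_fun_def: "r *\<^sub>R f = (\<lambda>x. r *\<^sub>R f x)"

instance
  by standard (simp_all add: scaleR_fun_def fun_eq_iff algebra_simps)

end


section \<open>Smooth manifolds\<close>

fun Ck_on :: "nat \<Rightarrow> 'e::real_normed_vector set \<Rightarrow> ('e \<Rightarrow> 'f::real_normed_vector) \<Rightarrow> bool" where
  "Ck_on 0 S f \<longleftrightarrow> continuous_on S f"
| "Ck_on (Suc k) S f \<longleftrightarrow>
     (\<forall>x\<in>S. f differentiable (at x)) \<and>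
     (\<forall>v. Ck_on k S (\<lambda>x. frechet_derivative f (at x) v))"

text \<open>Only used for open \<open>S\<close> in a Euclidean space, where it is the usual class of
  infinitely differentiable functions.\<close>

definition smooth_on :: "'e::real_normed_vector set \<Rightarrow> ('e \<Rightarrow> 'f::real_normed_vector) \<Rightarrow> bool" where
  "smooth_on S f \<longleftrightarrow> (\<forall>k. Ck_on k S f)"

text \<open>A chart is a pair \<open>(U, \<phi>)\<close>; the values of \<open>\<phi>\<close> outside \<open>U\<close> are irrelevant.\<close>

type_synonym ('a, 'e) chart = "'a set \<times> ('a \<Rightarrow> 'e)"

abbreviation chart_dom :: "('a, 'e) chart \<Rightarrow> 'a set" where "chart_dom \<equiv> fst"

abbreviation chart_map :: "('a, 'e) chart \<Rightarrow> 'a \<Rightarrow> 'e" where "chart_map \<equiv> snd"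

definition chart_img :: "('a, 'e) chart \<Rightarrow> 'e set" where
  "chart_img c = chart_map c ` chart_dom c"

definition chart_inv :: "('a, 'e) chart \<Rightarrow> 'e \<Rightarrow> 'a" where
  "chart_inv c = inv_into (chart_dom c) (chart_map c)"

definition is_chart :: "'a topology \<Rightarrow> ('a, 'e::euclidean_space) chart \<Rightarrow> bool" where
  "is_chart M c \<longleftrightarrow>
     openin M (chart_dom c) \<and> open (chart_img c) \<and>
     homeomorphic_map (subtopology M (chart_dom c)) (top_of_set (chart_img c)) (chart_map c)"

text \<open>The dimension of the manifold is \<open>DIM('e)\<close>. The atlas need not be maximal: smooth
  functions, fields and so on depend only on the maximal atlas it generates.\<close>

definition smooth_manifold :: "'a topology \<Rightarrow> ('a, 'e::euclidean_space) chart set \<Rightarrow> bool" where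
  "smooth_manifold M A \<longleftrightarrow>
     Hausdorff_space M \<and> second_countable M \<and>
     (\<forall>c\<in>A. is_chart M c) \<and>
     topspace M = (\<Union>c\<in>A. chart_dom c) \<and>
     (\<forall>c\<in>A. \<forall>c'\<in>A. smooth_on (chart_map c ` (chart_dom c \<inter> chart_dom c'))
                             (chart_map c' \<circ> chart_inv c))"

definition charts_at :: "('a, 'e) chart set \<Rightarrow> 'a \<Rightarrow> ('a, 'e) chart set" where
  "charts_at A p = {c \<in> A. p \<in> chart_dom c}"

definition smooth_fun :: "('a, 'e::euclidean_space) chart set \<Rightarrow> ('a \<Rightarrow> real) \<Rightarrow> bool" where
  "smooth_fun A f \<longleftrightarrow> (\<forall>c\<in>A. smooth_on (chart_img c) (f \<circ> chart_inv c))"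


section \<open>Tangent vectors and vector fields\<close>

text \<open>A tangent vector at \<open>p\<close> is given by its components \<open>v c\<close> in every chart \<open>c\<close> at \<open>p\<close>,
  which transform by the derivative of the coordinate changes. The value is set to 0 in
  charts that do not contain \<open>p\<close>, so that equal tangent vectors are equal functions and the
  tangent space at a point outside the manifold is trivial. In particular, identities
  between vector fields can be stated as equations between functions.\<close>

type_synonym ('a, 'e) tangent = "('a, 'e) chart \<Rightarrow> 'e"

type_synonym ('a, 'e) vfield = "'a \<Rightarrow> ('a, 'e) tangent"

definition tangent_space ::
  "('a, 'e::euclidean_space) chart set \<Rightarrow> 'a \<Rightarrow> ('a, 'e) tangent set" where
  "tangent_space A p =
     {v. (\<forall>c. c \<notin> charts_at A p \<longrightarrow> v c = 0) \<and>
         (\<forall>c\<in>charts_at A p. \<forall>c'\<in>charts_at A p.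
            v c' = frechet_derivative (chart_map c' \<circ> chart_inv c) (at (chart_map c p)) (v c))}"

definition vector_fields :: "('a, 'e::euclidean_space) chart set \<Rightarrow> ('a, 'e) vfield set" where
  "vector_fields A =
     {X. (\<forall>p. X p \<in> tangent_space A p) \<and>
         (\<forall>c\<in>A. smooth_on (chart_img c) (\<lambda>x. X (chart_inv c x) c))}"

definition scale_field :: "('a \<Rightarrow> real) \<Rightarrow> ('a, 'e::euclidean_space) vfield \<Rightarrow> ('a, 'e) vfield" where
  "scale_field f X = (\<lambda>p. f p *\<^sub>R X p)"

text \<open>The derivative \<open>X f\<close>. By the chain rule the choice of the chart at \<open>p\<close> is immaterial.\<close>

definition deriv_along ::
  "('a, 'e::euclidean_space) chart set \<Rightarrow> ('a, 'e) vfield \<Rightarrow> ('a \<Rightarrow> real) \<Rightarrow> 'a \<Rightarrow> real" where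
  "deriv_along A X f p =
     (let c = (SOME c. c \<in> charts_at A p)
      in frechet_derivative (f \<circ> chart_inv c) (at (chart_map c p)) (X p c))"

text \<open>In coordinates \<open>[X,Y]\<^sup>k = X\<^sup>i \<partial>\<^sub>i Y\<^sup>k - Y\<^sup>i \<partial>\<^sub>i X\<^sup>k\<close>, that is, \<open>[X,Y] f = X (Y f) - Y (X f)\<close>.\<close>

definition lie_bracket ::
  "('a, 'e::euclidean_space) chart set \<Rightarrow> ('a, 'e) vfield \<Rightarrow> ('a, 'e) vfield \<Rightarrow> ('a, 'e) vfield" where
  "lie_bracket A X Y = (\<lambda>p c.
     if c \<in> charts_at A p
     then frechet_derivative (\<lambda>x. Y (chart_inv c x) c) (at (chart_map c p)) (X p c)
        - frechet_derivative (\<lambda>x. X (chart_inv c x) c) (at (chart_map c p)) (Y p c)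
     else 0)"


section \<open>Traces\<close>

text \<open>The trace of a linear endomorphism \<open>L\<close> of a finite-dimensional subspace \<open>T\<close>: the sum
  of the diagonal matrix entries in some (equivalently, any) basis of \<open>T\<close>.\<close>

definition trace_on :: "'v::real_vector set \<Rightarrow> ('v \<Rightarrow> 'v) \<Rightarrow> real" where
  "trace_on T L =
     (let B = (SOME B. independent B \<and> span B = T)
      in \<Sum>b\<in>B. representation B (L b) b)"

text \<open>The trace at \<open>p\<close> of an operator \<open>L\<close> on vector fields that is linear over the smooth
  functions. For such an operator \<open>(L X) p\<close> depends only on \<open>X p\<close>, so \<open>L\<close> induces an
  endomorphism of the tangent space at \<open>p\<close>, computed by extending tangent vectors to fields.\<close>

definition field_trace ::
  "('a, 'e::euclidean_space) chart set \<Rightarrow> (('a, 'e) vfield \<Rightarrow> ('a, 'e) vfield) \<Rightarrow> 'a \<Rightarrow> real" where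
  "field_trace A L p =
     trace_on (tangent_space A p) (\<lambda>v. L (SOME X. X \<in> vector_fields A \<and> X p = v) p)"


section \<open>Riemannian metrics and the Levi-Civita connection\<close>

type_synonym ('a, 'e) metric = "'a \<Rightarrow> ('a, 'e) tangent \<Rightarrow> ('a, 'e) tangent \<Rightarrow> real"

definition riemannian_metric ::
  "('a, 'e::euclidean_space) chart set \<Rightarrow> ('a, 'e) metric \<Rightarrow> bool" where
  "riemannian_metric A g \<longleftrightarrow>
     (\<forall>p. \<forall>u\<in>tangent_space A p. \<forall>v\<in>tangent_space A p.
        g p u v = g p v u \<and>
        (\<forall>w\<in>tangent_space A p. g p (u + w) v = g p u v + g p w v) \<and>
        (\<forall>r. g p (r *\<^sub>R u) v = r * g p u v) \<and>
        (u \<noteq> 0 \<longrightarrow> g p u u > 0)) \<and>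
     (\<forall>X\<in>vector_fields A. \<forall>Y\<in>vector_fields A. smooth_fun A (\<lambda>p. g p (X p) (Y p)))"

definition riemannian_manifold ::
  "'a topology \<Rightarrow> ('a, 'e::euclidean_space) chart set \<Rightarrow> ('a, 'e) metric \<Rightarrow> bool" where
  "riemannian_manifold M A g \<longleftrightarrow> smooth_manifold M A \<and> riemannian_metric A g"

type_synonym ('a, 'e) connection = "('a, 'e) vfield \<Rightarrow> ('a, 'e) vfield \<Rightarrow> ('a, 'e) vfield"

definition affine_connection ::
  "('a, 'e::euclidean_space) chart set \<Rightarrow> ('a, 'e) connection \<Rightarrow> bool" where
  "affine_connection A nabla \<longleftrightarrow>
     (\<forall>X\<in>vector_fields A. \<forall>Y\<in>vector_fields A.
        nabla X Y \<in> vector_fields A \<and>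
        (\<forall>Z\<in>vector_fields A.
           nabla (X + Z) Y = nabla X Y + nabla Z Y \<and>
           nabla X (Y + Z) = nabla X Y + nabla X Z) \<and>
        (\<forall>f. smooth_fun A f \<longrightarrow>
           nabla (scale_field f X) Y = scale_field f (nabla X Y) \<and>
           nabla X (scale_field f Y) =
             scale_field f (nabla X Y) + scale_field (deriv_along A X f) Y))"

text \<open>Only the values of \<open>nabla\<close> on smooth vector fields matter; these are uniquely
  determined.\<close>

definition levi_civita ::
  "'a topology \<Rightarrow> ('a, 'e::euclidean_space) chart set \<Rightarrow> ('a, 'e) metric \<Rightarrow>
   ('a, 'e) connection \<Rightarrow> bool" where
  "levi_civita M A g nabla \<longleftrightarrow>
     affine_connection A nabla \<and>
     (\<forall>X\<in>vector_fields A. \<forall>Y\<in>vector_fields A.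
        nabla X Y - nabla Y X = lie_bracket A X Y) \<and>
     (\<forall>X\<in>vector_fields A. \<forall>Y\<in>vector_fields A. \<forall>Z\<in>vector_fields A. \<forall>p\<in>topspace M.
        deriv_along A X (\<lambda>q. g q (Y q) (Z q)) p =
          g p (nabla X Y p) (Z p) + g p (Y p) (nabla X Z p))"


section \<open>Tensor fields and curvature\<close>

text \<open>Covariant tensor fields are treated as function-valued maps on vector fields.\<close>

type_synonym ('a, 'e) tensor2 = "('a, 'e) vfield \<Rightarrow> ('a, 'e) vfield \<Rightarrow> 'a \<Rightarrow> real"

type_synonym ('a, 'e) tensor4 =
  "('a, 'e) vfield \<Rightarrow> ('a, 'e) vfield \<Rightarrow> ('a, 'e) vfield \<Rightarrow> ('a, 'e) vfield \<Rightarrow> 'a \<Rightarrow> real"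

definition metric_tensor :: "('a, 'e) metric \<Rightarrow> ('a, 'e) tensor2" where
  "metric_tensor g X Y p = g p (X p) (Y p)"

definition kulkarni_nomizu ::
  "('a, 'e) tensor2 \<Rightarrow> ('a, 'e) tensor2 \<Rightarrow> ('a, 'e) tensor4" (infixl "\<odot>\<^sub>K\<^sub>N" 70) where
  "(T1 \<odot>\<^sub>K\<^sub>N T2) X Y Z W p =
     T1 X W p * T2 Y Z p + T1 Y Z p * T2 X W p - T1 X Z p * T2 Y W p - T1 Y W p * T2 X Z p"

definition G_tensor :: "('a, 'e) metric \<Rightarrow> ('a, 'e) tensor4" where
  "G_tensor g X Y Z W p = 1/2 * (metric_tensor g \<odot>\<^sub>K\<^sub>N metric_tensor g) X Y Z W p"

definition lie_derivative ::
  "('a, 'e::euclidean_space) chart set \<Rightarrow> ('a, 'e) vfield \<Rightarrow> ('a, 'e) tensor2 \<Rightarrow> ('a, 'e) tensor2" where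
  "lie_derivative A V T X Y p =
     deriv_along A V (T X Y) p - T (lie_bracket A V X) Y p - T X (lie_bracket A V Y) p"

definition curvature ::
  "('a, 'e::euclidean_space) chart set \<Rightarrow> ('a, 'e) connection \<Rightarrow>
   ('a, 'e) vfield \<Rightarrow> ('a, 'e) vfield \<Rightarrow> ('a, 'e) vfield \<Rightarrow> ('a, 'e) vfield" where
  "curvature A nabla X Y Z =
     nabla X (nabla Y Z) - nabla Y (nabla X Z) - nabla (lie_bracket A X Y) Z"

definition riemann_tensor ::
  "('a, 'e::euclidean_space) chart set \<Rightarrow> ('a, 'e) metric \<Rightarrow> ('a, 'e) connection \<Rightarrow>
   ('a, 'e) tensor4" where
  "riemann_tensor A g nabla X Y Z W p = g p (curvature A nabla X Y Z p) (W p)"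

definition ricci_tensor ::
  "('a, 'e::euclidean_space) chart set \<Rightarrow> ('a, 'e) connection \<Rightarrow> ('a, 'e) tensor2" where
  "ricci_tensor A nabla Y Z p = field_trace A (\<lambda>X. curvature A nabla X Y Z) p"

definition divergence ::
  "('a, 'e::euclidean_space) chart set \<Rightarrow> ('a, 'e) connection \<Rightarrow> ('a, 'e) vfield \<Rightarrow> 'a \<Rightarrow> real" where
  "divergence A nabla V p = field_trace A (\<lambda>X. nabla X V) p"

definition solenoidal ::
  "'a topology \<Rightarrow> ('a, 'e::euclidean_space) chart set \<Rightarrow> ('a, 'e) connection \<Rightarrow>
   ('a, 'e) vfield \<Rightarrow> bool" where
  "solenoidal M A nabla V \<longleftrightarrow> (\<forall>p\<in>topspace M. divergence A nabla V p = 0)"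


section \<open>Solitons\<close>

definition soliton_data ::
  "'a topology \<Rightarrow> ('a, 'e::euclidean_space) chart set \<Rightarrow> ('a, 'e) vfield \<Rightarrow> ('a \<Rightarrow> real) \<Rightarrow> bool" where
  "soliton_data M A V l \<longleftrightarrow>
     V \<in> vector_fields A \<and> (\<forall>p\<in>topspace M. V p \<noteq> 0) \<and> smooth_fun A l"

definition almost_riemann_soliton ::
  "'a topology \<Rightarrow> ('a, 'e::euclidean_space) chart set \<Rightarrow> ('a, 'e) metric \<Rightarrow> ('a, 'e) connection \<Rightarrow>
   ('a, 'e) vfield \<Rightarrow> ('a \<Rightarrow> real) \<Rightarrow> bool" where
  "almost_riemann_soliton M A g nabla V l \<longleftrightarrow>
     soliton_data M A V l \<and>
     (\<forall>X\<in>vector_fields A. \<forall>Y\<in>vector_fields A. \<forall>Z\<in>vector_fields A. \<forall>W\<in>vector_fields A.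
      \<forall>p\<in>topspace M.
        1/2 * (lie_derivative A V (metric_tensor g) \<odot>\<^sub>K\<^sub>N metric_tensor g) X Y Z W p
          + riemann_tensor A g nabla X Y Z W p
        = l p * G_tensor g X Y Z W p)"

definition almost_ricci_soliton ::
  "'a topology \<Rightarrow> ('a, 'e::euclidean_space) chart set \<Rightarrow> ('a, 'e) metric \<Rightarrow> ('a, 'e) connection \<Rightarrow>
   ('a, 'e) vfield \<Rightarrow> ('a \<Rightarrow> real) \<Rightarrow> bool" where
  "almost_ricci_soliton M A g nabla V l \<longleftrightarrow>
     soliton_data M A V l \<and>
     (\<forall>X\<in>vector_fields A. \<forall>Y\<in>vector_fields A. \<forall>p\<in>topspace M.
        1/2 * lie_derivative A V (metric_tensor g) X Y p + ricci_tensor A nabla X Y p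
        = l p * metric_tensor g X Y p)"

definition almost_alpha_ricci_soliton ::
  "real \<Rightarrow> 'a topology \<Rightarrow> ('a, 'e::euclidean_space) chart set \<Rightarrow> ('a, 'e) metric \<Rightarrow>
   ('a, 'e) connection \<Rightarrow> ('a, 'e) vfield \<Rightarrow> ('a \<Rightarrow> real) \<Rightarrow> bool" where
  "almost_alpha_ricci_soliton \<alpha> M A g nabla V l \<longleftrightarrow>
     soliton_data M A V l \<and>
     (\<forall>X\<in>vector_fields A. \<forall>Y\<in>vector_fields A. \<forall>p\<in>topspace M.
        1/2 * lie_derivative A V (metric_tensor g) X Y p + \<alpha> * ricci_tensor A nabla X Y p
        = l p * metric_tensor g X Y p)"

end

theory Submission
  imports Defs
begin

text \<open>Put \<open>h = \<pounds>\<^sub>Vg / 2\<close>, so that \<open>h(X,Y) = (g(\<nabla>\<^sub>XV,Y) + g(X,\<nabla>\<^sub>YV)) / 2\<close> and the \<open>g\<close>-trace of \<open>h\<close>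
  is \<open>div V = 0\<close>. Contracting the soliton equation \<open>h \<odot> g + R = \<lambda>G\<close> in its first and last
  arguments gives \<open>(n - 2) h + Ric = (n - 1) \<lambda> g\<close>, from which both claims follow by scaling.
  The contraction is carried out at a point with a basis of the tangent space and its \<open>g\<close>-dual
  basis. Bump functions extend tangent vectors to global fields and show that \<open>(\<nabla>\<^sub>XV)(p)\<close>
  depends on \<open>X(p)\<close> only.\<close>

section \<open>Calculus of smooth maps\<close>

text \<open>Vector fields are global objects here, so coordinate frames are available only after a
  cut-off, and the cut-off needs closure properties of the recursively defined class
  \<open>Ck_on\<close>. The traces behind \<open>ricci_tensor\<close> and \<open>divergence\<close>
  use a basis and extensions of tangent vectors that are fixed by Hilbert choice. Such a basis need
  not be orthonormal, hence the dual basis: the diagonal entry of an operator L at \<open>b\<close>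
  is g(L b, d b). The soliton equation is applied to exactly those extensions that occur in the
  trace, so its curvature term is a summand of Ric as it stands. The terms with h, in contrast, must
  become values of a bilinear form on the tangent space before they can be contracted. This is what
  the dependence of the covariant derivative of V on X(p) alone is for.\<close>

lemma frechet_derivative_cong_open:
  assumes "open S" "x \<in> S" "\<And>y. y \<in> S \<Longrightarrow> f y = g y"
  shows "frechet_derivative f (at x) = frechet_derivative g (at x)"
proof -
  \<comment> \<open>\<open>frechet_derivative\<close> is a Hilbert choice among the derivatives.
    Equal sets of candidates give equal choices, so the equation also covers points where neither
    function is differentiable.\<close>
  have "(f has_derivative D) (at x) \<longleftrightarrow> (g has_derivative D) (at x)" for D
    using has_derivative_transform_within_open[of f D x UNIV S g]
      has_derivative_transform_within_open[of g D x UNIV S f] assms by force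
  then show ?thesis by (simp add: frechet_derivative_def)
qed

lemma differentiable_cong_open:
  assumes "open S" "x \<in> S" "\<And>y. y \<in> S \<Longrightarrow> f y = g y" "f differentiable at x"
  shows "g differentiable at x"
  using assms has_derivative_transform_within_open[of f _ x UNIV S g]
  unfolding differentiable_def by blast

lemma Ck_on_cong:
  assumes "open S" "\<And>x. x \<in> S \<Longrightarrow> f x = g x" "Ck_on k S f"
  shows "Ck_on k S g"
  using assms(2,3)
proof (induction k arbitrary: f g)
  case 0
  then show ?case by (simp cong: continuous_on_cong)
next
  case (Suc k)
  have "g differentiable at x" if "x \<in> S" for x
    using differentiable_cong_open[OF assms(1) that, of f g] Suc.prems that by auto
  moreover have "Ck_on k S (\<lambda>x. frechet_derivative g (at x) v)" for v
    by (rule Suc.IH[of "\<lambda>x. frechet_derivative f (at x) v"])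
      (use Suc.prems frechet_derivative_cong_open[OF assms(1), of _ f g] in auto)
  ultimately show ?case by simp
qed

lemma Ck_on_subset: "Ck_on k S f \<Longrightarrow> T \<subseteq> S \<Longrightarrow> Ck_on k T f"
  by (induction k arbitrary: f) (auto intro: continuous_on_subset)

lemma Ck_on_Un:
  "open S \<Longrightarrow> open T \<Longrightarrow> Ck_on k S f \<Longrightarrow> Ck_on k T f \<Longrightarrow> Ck_on k (S \<union> T) f"
  by (induction k arbitrary: f) (auto intro: continuous_on_open_Un)

lemma Ck_on_SucD: "Ck_on (Suc k) S f \<Longrightarrow> Ck_on k S f"
proof (induction k arbitrary: f)
  case 0
  then show ?case
    by (auto intro!: continuous_at_imp_continuous_on differentiable_imp_continuous_within)
next
  case (Suc k)
  from Suc.prems have "\<forall>x\<in>S. f differentiable at x"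
    and "Ck_on (Suc k) S (\<lambda>x. frechet_derivative f (at x) v)" for v
    by simp_all
  with Suc.IH show ?case by simp
qed

lemma Ck_on_const: "Ck_on k S (\<lambda>x. c)"
  by (induction k arbitrary: c) simp_all

lemma Ck_on_bounded_linear:
  assumes "bounded_linear L"
  shows "Ck_on k S L"
proof (cases k)
  case 0
  then show ?thesis using assms by (simp add: linear_continuous_on)
next
  case (Suc j)
  have "frechet_derivative L (at x) = L" for x
    using frechet_derivative_at[OF bounded_linear_imp_has_derivative[OF assms]] by simp
  with Suc show ?thesis
    using bounded_linear_imp_differentiable[OF assms] by (simp add: Ck_on_const)
qed

lemma Ck_on_add:
  assumes "open S" "Ck_on k S f" "Ck_on k S g"
  shows "Ck_on k S (\<lambda>x. f x + g x)"
  using assms(2,3)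
proof (induction k arbitrary: f g)
  case 0
  then show ?case by (simp add: continuous_on_add)
next
  case (Suc k)
  let ?D = "\<lambda>x v. frechet_derivative f (at x) v + frechet_derivative g (at x) v"
  have D: "((\<lambda>x. f x + g x) has_derivative ?D x) (at x)" if "x \<in> S" for x
    using Suc.prems that
    by (intro has_derivative_add) (auto simp: frechet_derivative_works[symmetric])
  have "Ck_on k S (\<lambda>x. frechet_derivative (\<lambda>x. f x + g x) (at x) v)" for v
  proof (rule Ck_on_cong[OF assms(1)])
    show "?D x v = frechet_derivative (\<lambda>x. f x + g x) (at x) v" if "x \<in> S" for x
      using frechet_derivative_at[OF D[OF that]] by metis
    show "Ck_on k S (\<lambda>x. ?D x v)"
      using Suc.prems by (intro Suc.IH) auto
  qed
  with differentiableI[OF D] show ?case by simp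
qed

lemma Ck_on_sum:
  assumes "open S" "\<And>i. i \<in> I \<Longrightarrow> Ck_on k S (f i)"
  shows "Ck_on k S (\<lambda>x. \<Sum>i\<in>I. f i x)"
  using assms(2)
  by (induction I rule: infinite_finite_induct) (auto simp: Ck_on_const intro: Ck_on_add[OF assms(1)])

lemma Ck_on_bilinear:
  assumes "open S" "bounded_bilinear B" "Ck_on k S f" "Ck_on k S g"
  shows "Ck_on k S (\<lambda>x. B (f x) (g x))"
  using assms(3,4)
proof (induction k arbitrary: f g)
  case 0
  then show ?case using bounded_bilinear.continuous_on[OF assms(2)] by simp
next
  case (Suc k)
  let ?D = "\<lambda>x v. B (f x) (frechet_derivative g (at x) v) + B (frechet_derivative f (at x) v) (g x)"
  have D: "((\<lambda>x. B (f x) (g x)) has_derivative ?D x) (at x)" if "x \<in> S" for x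
    using Suc.prems that
    by (intro bounded_bilinear.FDERIV[OF assms(2)]) (auto simp: frechet_derivative_works[symmetric])
  \<comment> \<open>Each term of the product rule keeps one factor undifferentiated, so both factors
    must also be known to have order \<open>k\<close>.\<close>
  have fg: "Ck_on k S f" "Ck_on k S g"
    using Suc.prems Ck_on_SucD by blast+
  have "Ck_on k S (\<lambda>x. frechet_derivative (\<lambda>x. B (f x) (g x)) (at x) v)" for v
  proof (rule Ck_on_cong[OF assms(1)])
    show "?D x v = frechet_derivative (\<lambda>x. B (f x) (g x)) (at x) v" if "x \<in> S" for x
      using frechet_derivative_at[OF D[OF that]] by metis
    show "Ck_on k S (\<lambda>x. ?D x v)"
      using Suc.prems fg by (intro Ck_on_add[OF assms(1)] Suc.IH) auto
  qed
  with differentiableI[OF D] show ?case by simp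
qed

text \<open>The chain rule differentiates the outer map in a direction that moves with the point,
  whereas \<open>Ck_on\<close> controls derivatives in fixed directions. Expanding along
  \<open>Basis\<close> moves the variation into scalar coefficients.\<close>

lemma frechet_derivative_euclidean:
  fixes f :: "'e::euclidean_space \<Rightarrow> 'f::real_normed_vector"
  assumes "f differentiable at x"
  shows "frechet_derivative f (at x) v = (\<Sum>b\<in>Basis. (v \<bullet> b) *\<^sub>R frechet_derivative f (at x) b)"
proof -
  have "linear (frechet_derivative f (at x))"
    using assms by (rule linear_frechet_derivative)
  then show ?thesis
    by (subst (1) euclidean_representation[of v, symmetric])
      (simp add: linear_sum linear_cmul)
qed

text \<open>Induction on the order with \<open>f\<close> generalised and \<open>g\<close> fixed. The
  chain rule yields products of components of the derivative of \<open>g\<close>, whose order is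
  given, with partial derivatives of \<open>f\<close> composed with the same \<open>g\<close>, which
  the induction hypothesis covers.\<close>

lemma Ck_on_compose:
  fixes f :: "'e::euclidean_space \<Rightarrow> 'f::real_normed_vector"
  assumes "open S" "Ck_on k T f" "Ck_on k S g" "g ` S \<subseteq> T"
  shows "Ck_on k S (\<lambda>x. f (g x))"
  using assms(2,3)
proof (induction k arbitrary: f)
  case 0
  then show ?case using assms(4) continuous_on_compose2 by fastforce
next
  case (Suc k)
  let ?D = "\<lambda>x v. frechet_derivative f (at (g x)) (frechet_derivative g (at x) v)"
  have f: "f differentiable at (g x)" and D: "((\<lambda>x. f (g x)) has_derivative ?D x) (at x)"
    if "x \<in> S" for x
  proof -
    show "f differentiable at (g x)"
      using Suc.prems assms(4) that by auto
    moreover have "g differentiable at x"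
      using Suc.prems that by auto
    ultimately show "((\<lambda>x. f (g x)) has_derivative ?D x) (at x)"
      using has_derivative_compose[of g "frechet_derivative g (at x)" x UNIV f]
      by (simp add: frechet_derivative_works)
  qed
  have "Ck_on k S (\<lambda>x. frechet_derivative (\<lambda>x. f (g x)) (at x) v)" for v
  proof (rule Ck_on_cong[OF assms(1)])
    show "(\<Sum>b\<in>Basis. (frechet_derivative g (at x) v \<bullet> b) *\<^sub>R frechet_derivative f (at (g x)) b)
        = frechet_derivative (\<lambda>x. f (g x)) (at x) v" if "x \<in> S" for x
      using frechet_derivative_at[OF D[OF that]] frechet_derivative_euclidean[OF f[OF that]] by metis
    have "Ck_on k S (\<lambda>x. frechet_derivative f (at (g x)) b)" for b
      using Suc.IH[of "\<lambda>y. frechet_derivative f (at y) b"] Suc.prems Ck_on_SucD by auto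
    moreover have "Ck_on k S (\<lambda>x. frechet_derivative g (at x) v \<bullet> b)" for b
      using Suc.prems
      by (intro Ck_on_bilinear[OF assms(1) bounded_bilinear_inner]) (auto simp: Ck_on_const)
    ultimately show "Ck_on k S (\<lambda>x. \<Sum>b\<in>Basis. (frechet_derivative g (at x) v \<bullet> b) *\<^sub>R
        frechet_derivative f (at (g x)) b)"
      by (intro Ck_on_sum[OF assms(1)] Ck_on_bilinear[OF assms(1) bounded_bilinear_scaleR])
  qed
  with differentiableI[OF D] show ?case by simp
qed

section \<open>Infinitely differentiable maps and bump functions\<close>

lemma smooth_on_cong:
  "open S \<Longrightarrow> (\<And>x. x \<in> S \<Longrightarrow> f x = g x) \<Longrightarrow> smooth_on S f \<Longrightarrow> smooth_on S g"
  unfolding smooth_on_def using Ck_on_cong by blast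

lemma smooth_on_Un:
  "open S \<Longrightarrow> open T \<Longrightarrow> smooth_on S f \<Longrightarrow> smooth_on T f \<Longrightarrow> smooth_on (S \<union> T) f"
  unfolding smooth_on_def using Ck_on_Un by blast

lemma smooth_on_const: "smooth_on S (\<lambda>x. c)"
  unfolding smooth_on_def using Ck_on_const by blast

lemma smooth_on_bounded_linear: "bounded_linear L \<Longrightarrow> smooth_on S L"
  unfolding smooth_on_def using Ck_on_bounded_linear by blast

lemma smooth_on_add:
  "open S \<Longrightarrow> smooth_on S f \<Longrightarrow> smooth_on S g \<Longrightarrow> smooth_on S (\<lambda>x. f x + g x)"
  unfolding smooth_on_def using Ck_on_add by blast

lemma smooth_on_sum:
  "open S \<Longrightarrow> (\<And>i. i \<in> I \<Longrightarrow> smooth_on S (f i)) \<Longrightarrow> smooth_on S (\<lambda>x. \<Sum>i\<in>I. f i x)"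
  by (simp add: smooth_on_def Ck_on_sum)

lemma smooth_on_bilinear:
  "open S \<Longrightarrow> bounded_bilinear B \<Longrightarrow> smooth_on S f \<Longrightarrow> smooth_on S g \<Longrightarrow>
    smooth_on S (\<lambda>x. B (f x) (g x))"
  unfolding smooth_on_def using Ck_on_bilinear by blast

lemmas smooth_on_scaleR = smooth_on_bilinear[OF _ bounded_bilinear_scaleR]
lemmas smooth_on_mult = smooth_on_bilinear[OF _ bounded_bilinear_mult]
lemmas smooth_on_inner = smooth_on_bilinear[OF _ bounded_bilinear_inner]

lemma smooth_on_compose:
  fixes f :: "'e::euclidean_space \<Rightarrow> 'f::real_normed_vector"
  assumes "open S" "smooth_on T f" "smooth_on S g" "g ` S \<subseteq> T"
  shows "smooth_on S (\<lambda>x. f (g x))"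
  using assms unfolding smooth_on_def by (blast intro: Ck_on_compose)

lemma smooth_on_differentiable: "smooth_on S f \<Longrightarrow> x \<in> S \<Longrightarrow> f differentiable at x"
  unfolding smooth_on_def by (metis Ck_on.simps(2))

lemma smooth_on_frechet_derivative:
  "smooth_on S f \<Longrightarrow> smooth_on S (\<lambda>x. frechet_derivative f (at x) v)"
  unfolding smooth_on_def by (metis Ck_on.simps(2))

text \<open>The exponent \<open>m\<close> is a parameter because the derivatives of exp(-1/t) are
  that function times polynomials in 1/t. The linear span of this family is closed under
  differentiation.\<close>

definition flat :: "nat \<Rightarrow> real \<Rightarrow> real" where
  "flat m t = (if t > 0 then exp (- inverse t) * inverse t ^ m else 0)"

text \<open>From the right, s = 1/t turns the claim into the decay of s^m / exp(s) at infinity; on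
  the left the function is zero.\<close>

lemma flat_tendsto_0: "(flat m \<longlongrightarrow> 0) (at 0)"
proof -
  have "((\<lambda>t::real. inverse t ^ m / exp (inverse t)) \<longlongrightarrow> 0) (at_right 0)"
    using filterlim_compose[OF tendsto_power_div_exp_0 filterlim_inverse_at_top_right] .
  then have "(flat m \<longlongrightarrow> 0) (at_right 0)"
    by (rule Lim_transform_eventually)
      (auto simp: eventually_at_filter flat_def exp_minus field_simps)
  moreover have "(flat m \<longlongrightarrow> 0) (at_left 0)"
    by (rule Lim_transform_eventually[OF tendsto_const])
      (auto simp: eventually_at_filter flat_def)
  ultimately show ?thesis
    by (simp add: filterlim_split_at)
qed

lemma flat_has_derivative:
  "(flat m has_real_derivative flat (m + 2) t - real m * flat (m + 1) t) (at t)"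
proof -
  consider "t > 0" | "t < 0" | "t = 0" by linarith
  then show ?thesis
  proof cases
    case 1
    have i: "(inverse has_real_derivative - (inverse t ^ 2)) (at t)"
      using DERIV_inverse[of t] 1 by (simp add: numeral_2_eq_2)
    then have "((\<lambda>t. - inverse t) has_real_derivative inverse t ^ 2) (at t)"
      using DERIV_minus by fastforce
    then have "((\<lambda>t. exp (- inverse t) * inverse t ^ m) has_real_derivative
        exp (- inverse t) * (inverse t ^ 2) * inverse t ^ m
        + of_nat m * (- (inverse t ^ 2) * inverse t ^ (m - Suc 0)) * exp (- inverse t)) (at t)"
      by (intro DERIV_mult DERIV_power[OF i] DERIV_fun_exp)
    moreover have "exp (- inverse t) * (inverse t ^ 2) * inverse t ^ m
        + of_nat m * (- (inverse t ^ 2) * inverse t ^ (m - Suc 0)) * exp (- inverse t)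
        = flat (m + 2) t - real m * flat (m + 1) t"
      using 1 by (cases m) (simp_all add: flat_def power2_eq_square algebra_simps)
    ultimately have "((\<lambda>t. exp (- inverse t) * inverse t ^ m) has_real_derivative
        flat (m + 2) t - real m * flat (m + 1) t) (at t)"
      by simp
    then show ?thesis
      by (rule has_field_derivative_transform_within_open[where S="{0<..}"]) (use 1 in \<open>auto simp: flat_def\<close>)
  next
    case 2
    have "((\<lambda>t. 0) has_real_derivative flat (m + 2) t - real m * flat (m + 1) t) (at t)"
      using 2 by (simp add: flat_def)
    then show ?thesis
      by (rule has_field_derivative_transform_within_open[where S="{..<0}"]) (use 2 in \<open>auto simp: flat_def\<close>)
  next
    case 3
    \<comment> \<open>Division by \<open>h\<close> adds one power of 1/h, so the difference quotient
      at 0 is \<open>flat (Suc m)\<close>, which tends to 0.\<close>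
    have "((\<lambda>h. (flat m (0 + h) - flat m 0) / h) \<longlongrightarrow> 0) (at 0)"
      by (rule Lim_transform_eventually[OF flat_tendsto_0[of "Suc m"]])
        (auto simp: eventually_at_filter flat_def field_simps)
    with 3 show ?thesis by (simp add: DERIV_def flat_def)
  qed
qed

lemma smooth_on_flat: "smooth_on S (flat m)"
proof -
  have d: "(flat m has_derivative (\<lambda>v. (flat (m + 2) t - real m * flat (m + 1) t) * v)) (at t)" for m t
    using flat_has_derivative by (simp add: has_field_derivative_def)
  \<comment> \<open>All \<open>m\<close> are treated at once, since the derivative involves the
    exponents m + 1 and m + 2.\<close>
  have "Ck_on k UNIV (flat m)" for k
  proof (induction k arbitrary: m)
    case 0
    show ?case
      by (auto intro!: continuous_at_imp_continuous_on DERIV_isCont flat_has_derivative)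
  next
    case (Suc k)
    have "Ck_on k UNIV (\<lambda>t. frechet_derivative (flat m) (at t) v)" for v
    proof (rule Ck_on_cong[OF open_UNIV])
      show "flat (m + 2) t * v + flat (m + 1) t * (- real m * v)
          = frechet_derivative (flat m) (at t) v" for t
        unfolding frechet_derivative_at[OF d, symmetric] by (simp add: algebra_simps)
      show "Ck_on k UNIV (\<lambda>t. flat (m + 2) t * v + flat (m + 1) t * (- real m * v))"
        by (intro Ck_on_add Ck_on_bilinear[OF _ bounded_bilinear_mult] Suc.IH Ck_on_const open_UNIV)
    qed
    with differentiableI[OF d] show ?case by simp
  qed
  then show ?thesis
    by (auto simp: smooth_on_def intro: Ck_on_subset)
qed

lemma smooth_bump:
  fixes x :: "'e::euclidean_space"
  assumes "r > 0"
  obtains b :: "'e \<Rightarrow> real" where "\<And>S. open S \<Longrightarrow> smooth_on S b" "b x = 1" "\<And>y. y \<notin> cball x r \<Longrightarrow> b y = 0"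
proof
  \<comment> \<open>\<open>?q\<close> is positive exactly on the open ball of radius
    \<open>r\<close> and equals r^2 at the centre, which explains the normalising factor in
    \<open>?b\<close>. Subtractions are written as sums and products to match the closure
    rules.\<close>
  let ?q = "\<lambda>y. r\<^sup>2 + (- 1) * ((y + - x) \<bullet> (y + - x))"
  let ?b = "\<lambda>y. inverse (flat 0 (r\<^sup>2)) * flat 0 (?q y)"
  show "smooth_on S ?b" if "open S" for S
    by (intro that smooth_on_mult smooth_on_const smooth_on_compose[OF _ smooth_on_flat[of UNIV]]
        smooth_on_add smooth_on_inner smooth_on_bounded_linear bounded_linear_ident) simp
  show "?b x = 1"
    using assms by (simp add: flat_def)
  show "?b y = 0" if "y \<notin> cball x r" for y
  proof -
    have "r < norm (y - x)"
      using that by (simp add: dist_norm norm_minus_commute)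
    then have "r\<^sup>2 \<le> (y - x) \<bullet> (y - x)"
      using assms by (simp add: power2_norm_eq_inner[symmetric] power_mono)
    then show ?thesis by (simp add: flat_def)
  qed
qed

section \<open>Dual bases\<close>

text \<open>Linearity relative to a subspace: the metric and the covariant derivative at a point are
  controlled on the tangent space only, while the ambient type contains all functions on
  charts.\<close>

definition linear_within :: "'v::real_vector set \<Rightarrow> ('v \<Rightarrow> 'w::real_vector) \<Rightarrow> bool" where
  "linear_within T f \<longleftrightarrow>
     (\<forall>u\<in>T. \<forall>v\<in>T. f (u + v) = f u + f v) \<and> (\<forall>r. \<forall>u\<in>T. f (r *\<^sub>R u) = r *\<^sub>R f u)"

lemma linear_within_add: "linear_within T f \<Longrightarrow> u \<in> T \<Longrightarrow> v \<in> T \<Longrightarrow> f (u + v) = f u + f v"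
  and linear_within_scaleR: "linear_within T f \<Longrightarrow> u \<in> T \<Longrightarrow> f (r *\<^sub>R u) = r *\<^sub>R f u"
  by (simp_all add: linear_within_def)

lemma linear_within_sum:
  assumes "subspace T" "linear_within T f" "\<And>i. i \<in> I \<Longrightarrow> u i \<in> T"
  shows "f (\<Sum>i\<in>I. r i *\<^sub>R u i) = (\<Sum>i\<in>I. r i *\<^sub>R f (u i))"
proof -
  have f0: "f 0 = 0"
    using linear_within_scaleR[OF assms(2), of 0 0] subspace_0[OF assms(1)] by simp
  show ?thesis
    using assms(3)
  proof (induction I rule: infinite_finite_induct)
    case (insert i I)
    have "(\<Sum>i\<in>I. r i *\<^sub>R u i) \<in> T" "r i *\<^sub>R u i \<in> T"
      using insert.prems by (auto intro!: subspace_sum subspace_scale assms(1))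
    with insert show ?case
      using linear_within_add[OF assms(2)] linear_within_scaleR[OF assms(2)] by simp
  qed (simp_all add: f0)
qed

lemma linear_within_compose:
  assumes "linear_within T N" "\<And>v. v \<in> T \<Longrightarrow> N v \<in> T" "linear_within T f"
  shows "linear_within T (\<lambda>v. f (N v))"
  using assms by (simp add: linear_within_def)

lemma linear_within_scaled_sum:
  assumes "linear_within T f" "linear_within T f'"
  shows "linear_within T (\<lambda>v. r *\<^sub>R (f v + f' v))"
  using assms by (simp add: linear_within_def algebra_simps)

locale inner_product_within =
  fixes T :: "'v::real_vector set" and g :: "'v \<Rightarrow> 'v \<Rightarrow> real"
  assumes subspace: "subspace T"
    and commute: "u \<in> T \<Longrightarrow> v \<in> T \<Longrightarrow> g u v = g v u"
    and add_left: "u \<in> T \<Longrightarrow> v \<in> T \<Longrightarrow> w \<in> T \<Longrightarrow> g (u + w) v = g u v + g w v"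
    and scale_left: "u \<in> T \<Longrightarrow> v \<in> T \<Longrightarrow> g (r *\<^sub>R u) v = r * g u v"
    and pos: "u \<in> T \<Longrightarrow> u \<noteq> 0 \<Longrightarrow> g u u > 0"
begin

lemmas closed = subspace_add[OF subspace] subspace_scale[OF subspace] subspace_0[OF subspace]
  subspace_diff[OF subspace]

lemma linear_left: "v \<in> T \<Longrightarrow> linear_within T (\<lambda>u. g u v)"
  by (simp add: linear_within_def add_left scale_left)

lemma linear_right: "u \<in> T \<Longrightarrow> linear_within T (g u)"
  unfolding linear_within_def
  by (metis add_left commute closed(1,2) real_scaleR_def scale_left)

lemma diff_left: "u \<in> T \<Longrightarrow> v \<in> T \<Longrightarrow> w \<in> T \<Longrightarrow> g (u - w) v = g u v - g w v"
  using add_left[of "u - w" v w] closed(4) by simp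

lemma diff_right: "u \<in> T \<Longrightarrow> v \<in> T \<Longrightarrow> w \<in> T \<Longrightarrow> g v (u - w) = g v u - g v w"
  using diff_left[of u v w] commute closed(4) by metis

lemma nondegenerate:
  assumes "u \<in> T" "\<And>v. v \<in> T \<Longrightarrow> g u v = 0"
  shows "u = 0"
  using pos[OF assms(1)] assms by fastforce

lemma orthogonal_span:
  assumes "S \<subseteq> T" "w \<in> T" "\<And>s. s \<in> S \<Longrightarrow> g s w = 0" "u \<in> span S"
  shows "g u w = 0"
proof -
  have "subspace {u \<in> T. g u w = 0}"
    using assms(2) closed scale_left[of 0 w 0]
    by (auto simp: subspace_def add_left scale_left)
  then have "span S \<subseteq> {u \<in> T. g u w = 0}"
    using assms by (intro span_minimal) auto
  with assms(4) show ?thesis by auto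
qed

text \<open>A Gram-Schmidt step. The induction hypothesis is used for the new element
  \<open>a\<close> and for \<open>v\<close>; then the component along the corrected
  \<open>a'\<close> is removed. Keeping \<open>w - v\<close> in the span of \<open>S\<close> later
  shows that \<open>w\<close> is nonzero.\<close>

lemma orthogonal_complement:
  assumes "finite S" "S \<subseteq> T" "v \<in> T"
  shows "\<exists>w\<in>T. w - v \<in> span S \<and> (\<forall>s\<in>S. g s w = 0)"
  using assms
proof (induction S arbitrary: v rule: finite_induct)
  case empty
  then show ?case by auto
next
  case (insert a S)
  obtain a' where a': "a' \<in> T" "a' - a \<in> span S" "\<forall>s\<in>S. g s a' = 0"
    using insert by (metis insert_subset)
  obtain w where w: "w \<in> T" "w - v \<in> span S" "\<forall>s\<in>S. g s w = 0"
    using insert by (metis insert_subset)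
  \<comment> \<open>If \<open>a' = 0\<close>, then \<open>a\<close> already lies in the span of
    \<open>S\<close> and \<open>w'\<close> is just \<open>w\<close>.\<close>
  define w' where "w' = w - (g a' w / g a' a') *\<^sub>R a'"
  have w'T: "w' \<in> T"
    using w a' by (simp add: w'_def closed)
  have g_w': "g u w' = g u w - g a' w / g a' a' * g u a'" if "u \<in> T" for u
    using that w a' linear_within_scaleR[OF linear_right[OF that], of a']
    by (simp add: w'_def diff_right closed)
  have S: "g s w' = 0" if "s \<in> S" for s
    using that insert.prems a' w by (subst g_w') auto
  have "a' - a \<in> T"
    using a' insert.prems closed(4) by auto
  have "g a' w' = 0"
    using g_w'[OF a'(1)] pos[OF a'(1)] by (cases "a' = 0") (use scale_left[of 0 w' 0] w'T closed(3) in auto)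
  moreover have "g (a' - a) w' = 0"
    using orthogonal_span[of S w' "a' - a"] S w'T a'(2) insert.prems by auto
  ultimately have "g a w' = 0"
    using diff_left[of a' w' a] a' w'T insert.prems by auto
  moreover have "w' - v \<in> span (insert a S)"
  proof -
    have 1: "w - v \<in> span (insert a S)" "a' - a \<in> span (insert a S)" "a \<in> span (insert a S)"
      using w(2) a'(2) span_mono[of S "insert a S"] by (auto intro: span_base)
    then have "a' \<in> span (insert a S)"
      using span_add[OF 1(2,3)] by simp
    then have "(w - v) - (g a' w / g a' a') *\<^sub>R a' \<in> span (insert a S)"
      by (rule span_diff[OF 1(1) span_scale])
    moreover have "(w - v) - (g a' w / g a' a') *\<^sub>R a' = w' - v"
      by (simp add: w'_def)
    ultimately show ?thesis by simp
  qed
  ultimately show ?case using w'T S by blast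
qed

end

text \<open>\<open>B\<close> stays an arbitrary basis, so that it can be the one chosen inside
  \<open>trace_on\<close>; its \<open>g\<close>-dual \<open>d\<close> turns coordinates into values
  of the metric.\<close>

locale dual_bases = inner_product_within T g
  for T :: "'v::real_vector set" and g +
  fixes B :: "'v set" and d :: "'v \<Rightarrow> 'v"
  assumes finite_B: "finite B" and independent_B: "independent B" and span_B: "span B = T"
    and dual_in: "b \<in> B \<Longrightarrow> d b \<in> T"
    and dual: "b \<in> B \<Longrightarrow> b' \<in> B \<Longrightarrow> g b' (d b) = (if b' = b then 1 else 0)"

text \<open>The dual vector of \<open>b\<close> is the part of \<open>b\<close> orthogonal to the
  other basis elements, rescaled.\<close>

lemma (in inner_product_within) dual_basis_exists:
  assumes B: "finite B" "independent B" "span B = T"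
  shows "\<exists>d. dual_bases T g B d"
proof -
  have BT: "B \<subseteq> T"
    using B span_superset by auto
  have "\<exists>w\<in>T. \<forall>b'\<in>B. g b' w = (if b' = b then 1 else 0)" if b: "b \<in> B" for b
  proof -
    obtain w where w: "w \<in> T" "w - b \<in> span (B - {b})" "\<forall>s\<in>B - {b}. g s w = 0"
      using orthogonal_complement[of "B - {b}" b] B BT b by auto
    \<comment> \<open>Otherwise \<open>b\<close> would lie in the span of the remaining elements,
      against independence.\<close>
    have "w \<noteq> 0"
      using B(2) b w(2) span_neg[of "- b" "B - {b}"] by (auto simp: dependent_def)
    have "g (w - b) w = 0"
      using orthogonal_span[of "B - {b}" w "w - b"] w BT by auto
    then have "g b w = g w w"
      using diff_left[of w w b] w BT b by auto
    with pos[OF w(1) \<open>w \<noteq> 0\<close>] have gb: "g b w > 0" by simp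
    show ?thesis
    proof (rule bexI[of _ "(1 / g b w) *\<^sub>R w"], intro ballI)
      show "(1 / g b w) *\<^sub>R w \<in> T" using w closed by simp
      show "g b' ((1 / g b w) *\<^sub>R w) = (if b' = b then 1 else 0)" if "b' \<in> B" for b'
      proof -
        have "b' \<in> T" using that BT by auto
        then show ?thesis
          using linear_within_scaleR[OF linear_right w(1), of b' "1 / g b w"] w that gb by auto
      qed
    qed
  qed
  then obtain d where "\<forall>b\<in>B. d b \<in> T \<and> (\<forall>b'\<in>B. g b' (d b) = (if b' = b then 1 else 0))"
    by metis
  with B have "dual_bases T g B d"
    by unfold_locales auto
  then show ?thesis by blast
qed

context dual_bases
begin

lemma B_in: "b \<in> B \<Longrightarrow> b \<in> T"
  using span_B span_base by auto

lemma representation_eq: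
  assumes "v \<in> T" "b \<in> B"
  shows "representation B v b = g v (d b)"
proof -
  have "g v (d b) = g (\<Sum>b'\<in>B. representation B v b' *\<^sub>R b') (d b)"
    using sum_representation_eq[of B v B] independent_B finite_B span_B assms by simp
  also have "\<dots> = (\<Sum>b'\<in>B. representation B v b' *\<^sub>R g b' (d b))"
    by (rule linear_within_sum[OF subspace linear_left]) (use assms dual_in B_in in auto)
  also have "\<dots> = representation B v b"
    using assms finite_B by (simp add: dual if_distrib cong: if_cong)
  finally show ?thesis ..
qed

lemma expand_B:
  assumes "v \<in> T"
  shows "v = (\<Sum>b\<in>B. g v (d b) *\<^sub>R b)"
  using sum_representation_eq[of B v B] independent_B finite_B span_B assms
  by (simp add: representation_eq)

text \<open>The difference of the two sides pairs to zero with each element of \<open>B\<close>,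
  hence with all of \<open>T\<close>, and \<open>g\<close> is definite.\<close>

lemma expand_dual:
  assumes "v \<in> T"
  shows "v = (\<Sum>b\<in>B. g b v *\<^sub>R d b)"
proof -
  let ?w = "\<Sum>b\<in>B. g b v *\<^sub>R d b"
  have wT: "?w \<in> T"
    by (intro subspace_sum subspace_scale subspace dual_in)
  have "g b (v - ?w) = 0" if "b \<in> B" for b
  proof -
    have "g b ?w = (\<Sum>b'\<in>B. g b' v *\<^sub>R g b (d b'))"
      by (rule linear_within_sum[OF subspace linear_right]) (use that dual_in B_in in auto)
    also have "\<dots> = g b v"
      using that finite_B by (simp add: dual if_distrib cong: if_cong)
    finally show ?thesis
      using that wT assms B_in by (simp add: diff_right)
  qed
  then have "g u (v - ?w) = 0" if "u \<in> T" for u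
    using orthogonal_span[of B "v - ?w" u] B_in wT assms that span_B by (auto simp: closed)
  then have "v - ?w = 0"
    using nondegenerate[of "v - ?w"] wT assms commute closed(4) by metis
  then show ?thesis by simp
qed

text \<open>Index contraction: pairing one slot with \<open>v\<close> while the other runs through
  the basis substitutes \<open>v\<close> into \<open>f\<close>. It evaluates the mixed terms of a
  Kulkarni-Nomizu product.\<close>

lemma contract_B:
  fixes f :: "'v \<Rightarrow> real"
  assumes "linear_within T f" "v \<in> T"
  shows "(\<Sum>b\<in>B. f b * g v (d b)) = f v"
  using linear_within_sum[OF subspace assms(1), of B "\<lambda>b. b" "\<lambda>b. g v (d b)"] B_in
    expand_B[OF assms(2)] by (simp add: mult.commute)

lemma contract_dual:
  fixes f :: "'v \<Rightarrow> real"
  assumes "linear_within T f" "v \<in> T"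
  shows "(\<Sum>b\<in>B. f (d b) * g b v) = f v"
  using linear_within_sum[OF subspace assms(1), of B d "\<lambda>b. g b v"] dual_in
    expand_dual[OF assms(2)] by (simp add: mult.commute)

text \<open>An operator and its \<open>g\<close>-adjoint have the same trace. Expanding
  \<open>d b\<close> in \<open>B\<close> produces the Gram matrix of the dual basis; its symmetry
  allows the two summations to be exchanged and contracted the other way.\<close>

lemma trace_dual:
  assumes N: "linear_within T N" "\<And>v. v \<in> T \<Longrightarrow> N v \<in> T"
  shows "(\<Sum>b\<in>B. g b (N (d b))) = (\<Sum>b\<in>B. g (N b) (d b))"
proof -
  have "g b (N (d b)) = (\<Sum>b'\<in>B. g b (N b') * g (d b) (d b'))" if "b \<in> B" for b
    using contract_B[OF linear_within_compose[OF N linear_right], of b "d b"] that dual_in B_in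
    by simp
  then have "(\<Sum>b\<in>B. g b (N (d b))) = (\<Sum>b\<in>B. \<Sum>b'\<in>B. g b (N b') * g (d b) (d b'))"
    by simp
  also have "\<dots> = (\<Sum>b'\<in>B. \<Sum>b\<in>B. g b (N b') * g (d b') (d b))"
    using commute dual_in by (subst sum.swap) (simp cong: sum.cong)
  also have "\<dots> = (\<Sum>b'\<in>B. g (d b') (N b'))"
    using contract_B linear_left dual_in N(2) B_in by (intro sum.cong) simp_all
  also have "\<dots> = (\<Sum>b\<in>B. g (N b) (d b))"
    using commute dual_in N(2) B_in by (intro sum.cong) simp_all
  finally show ?thesis .
qed

end

section \<open>Charts, tangent spaces and extension of fields\<close>

locale atlas =
  fixes M :: "'a topology" and A :: "('a, 'e::euclidean_space) chart set"
  assumes manifold: "smooth_manifold M A"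
begin

lemma chart: "c \<in> A \<Longrightarrow> is_chart M c"
  and Hausdorff: "Hausdorff_space M"
  and topspace_eq: "topspace M = (\<Union>c\<in>A. chart_dom c)"
  using manifold unfolding smooth_manifold_def by blast+

lemma openin_chart_dom: "c \<in> A \<Longrightarrow> openin M (chart_dom c)"
  and open_chart_img: "c \<in> A \<Longrightarrow> open (chart_img c)"
  using chart by (auto simp: is_chart_def)

lemma chart_homeomorphic:
  "c \<in> A \<Longrightarrow> homeomorphic_map (subtopology M (chart_dom c)) (top_of_set (chart_img c)) (chart_map c)"
  using chart by (auto simp: is_chart_def)

lemma chart_dom_subset: "c \<in> A \<Longrightarrow> chart_dom c \<subseteq> topspace M"
  using topspace_eq by auto

lemma inj_on_chart: "c \<in> A \<Longrightarrow> inj_on (chart_map c) (chart_dom c)"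
  using homeomorphic_imp_injective_map[OF chart_homeomorphic] chart_dom_subset
  by (simp add: Int_absorb1)

lemma chart_inv_map [simp]: "c \<in> A \<Longrightarrow> p \<in> chart_dom c \<Longrightarrow> chart_inv c (chart_map c p) = p"
  by (simp add: chart_inv_def inj_on_chart)

lemma chart_map_inv [simp]: "x \<in> chart_img c \<Longrightarrow> chart_map c (chart_inv c x) = x"
  and chart_inv_in: "x \<in> chart_img c \<Longrightarrow> chart_inv c x \<in> chart_dom c"
  by (simp_all add: chart_inv_def chart_img_def f_inv_into_f inv_into_into)

lemma chart_map_in: "p \<in> chart_dom c \<Longrightarrow> chart_map c p \<in> chart_img c"
  by (simp add: chart_img_def)

lemma open_chart_image:
  assumes "c \<in> A" "openin M U"
  shows "open (chart_map c ` (chart_dom c \<inter> U))"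
proof -
  have "openin (subtopology M (chart_dom c)) (chart_dom c \<inter> U)"
    using assms by (simp add: openin_subtopology_Int2)
  then have "openin (top_of_set (chart_img c)) (chart_map c ` (chart_dom c \<inter> U))"
    using homeomorphic_imp_open_map[OF chart_homeomorphic[OF assms(1)]] by (simp add: open_map_def)
  then show ?thesis
    using open_chart_img[OF assms(1)] by (simp add: openin_open_eq)
qed

text \<open>The inverse chart carries compact sets to compact sets of \<open>M\<close>, and these
  are closed because \<open>M\<close> is Hausdorff. This is what makes extension by zero smooth on
  the whole manifold.\<close>

lemma closedin_chart_preimage:
  assumes "c \<in> A" "compact K" "K \<subseteq> chart_img c"
  shows "closedin M (chart_inv c ` K)"
proof -
  obtain h where h: "homeomorphic_maps (subtopology M (chart_dom c)) (top_of_set (chart_img c)) (chart_map c) h"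
    using chart_homeomorphic[OF assms(1)] homeomorphic_map_maps by blast
  have "h x = chart_inv c x" if "x \<in> chart_img c" for x
  proof -
    have "h x \<in> chart_dom c" "chart_map c (h x) = x"
      using h that
      by (auto simp: homeomorphic_maps_def continuous_map_def)
    then show ?thesis using chart_inv_map[OF assms(1)] by metis
  qed
  then have eq: "h ` K = chart_inv c ` K"
    using assms(3) by (auto intro!: image_cong)
  have "compactin (top_of_set (chart_img c)) K"
    using assms by (simp add: compactin_subtopology)
  then have "compactin (subtopology M (chart_dom c)) (h ` K)"
    using h image_compactin by (auto simp: homeomorphic_maps_def)
  then have "compactin M (chart_inv c ` K)"
    by (simp add: compactin_subtopology eq)
  then show ?thesis
    using compactin_imp_closedin[OF Hausdorff] by blast
qed

section \<open>Coordinate changes and tangent spaces\<close>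

abbreviation transition :: "('a, 'e) chart \<Rightarrow> ('a, 'e) chart \<Rightarrow> 'e \<Rightarrow> 'e" where
  "transition c c' \<equiv> chart_map c' \<circ> chart_inv c"

abbreviation overlap :: "('a, 'e) chart \<Rightarrow> ('a, 'e) chart \<Rightarrow> 'e set" where
  "overlap c c' \<equiv> chart_map c ` (chart_dom c \<inter> chart_dom c')"

abbreviation D :: "('a, 'e) chart \<Rightarrow> ('a, 'e) chart \<Rightarrow> 'a \<Rightarrow> 'e \<Rightarrow> 'e" where
  "D c c' p \<equiv> frechet_derivative (transition c c') (at (chart_map c p))"

lemma open_overlap: "c \<in> A \<Longrightarrow> c' \<in> A \<Longrightarrow> open (overlap c c')"
  using open_chart_image openin_chart_dom by blast

lemma smooth_transition: "c \<in> A \<Longrightarrow> c' \<in> A \<Longrightarrow> smooth_on (overlap c c') (transition c c')"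
  using manifold unfolding smooth_manifold_def by blast

lemma charts_atD: "c \<in> charts_at A p \<Longrightarrow> c \<in> A" "c \<in> charts_at A p \<Longrightarrow> p \<in> chart_dom c"
  by (auto simp: charts_at_def)

lemma transition_differentiable:
  assumes "c \<in> charts_at A p" "c' \<in> charts_at A p"
  shows "transition c c' differentiable (at (chart_map c p))"
  using assms by (intro smooth_on_differentiable[OF smooth_transition]) (auto simp: charts_at_def)

lemma linear_D: "c \<in> charts_at A p \<Longrightarrow> c' \<in> charts_at A p \<Longrightarrow> linear (D c c' p)"
  using transition_differentiable linear_frechet_derivative by blast

lemma D_refl:
  assumes "c \<in> charts_at A p"
  shows "D c c p v = v"
proof -
  have "D c c p = frechet_derivative (\<lambda>x. x) (at (chart_map c p))"
    using assms
    by (intro frechet_derivative_cong_open[of "chart_img c"])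
      (auto simp: charts_at_def chart_img_def open_chart_img[unfolded chart_img_def])
  then show ?thesis by simp
qed

text \<open>The cocycle rule, by the chain rule. The composite agrees with the direct coordinate
  change on the triple overlap, an open set around the point.\<close>

lemma D_trans:
  assumes "c \<in> charts_at A p" "c' \<in> charts_at A p" "c'' \<in> charts_at A p"
  shows "D c' c'' p (D c c' p v) = D c c'' p v"
proof -
  let ?x = "chart_map c p" and ?S = "chart_map c ` (chart_dom c \<inter> (chart_dom c' \<inter> chart_dom c''))"
  note A = assms[THEN charts_atD(1)] and p = assms[THEN charts_atD(2)]
  have "(transition c c' has_derivative D c c' p) (at ?x)"
    "(transition c' c'' has_derivative D c' c'' p) (at (transition c c' ?x))"
    using transition_differentiable[OF assms(1,2)] transition_differentiable[OF assms(2,3)] A p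
    by (simp_all add: frechet_derivative_works)
  then have "(transition c' c'' \<circ> transition c c' has_derivative D c' c'' p \<circ> D c c' p) (at ?x)"
    by (rule diff_chain_at)
  then have "D c' c'' p \<circ> D c c' p = frechet_derivative (transition c' c'' \<circ> transition c c') (at ?x)"
    by (rule frechet_derivative_at)
  also have "\<dots> = D c c'' p"
    by (rule frechet_derivative_cong_open[of ?S])
      (use A p in \<open>auto intro!: open_chart_image openin_Int openin_chart_dom\<close>)
  finally show ?thesis by (metis comp_apply)
qed

lemma charts_at_nonempty: "p \<in> topspace M \<Longrightarrow> \<exists>c. c \<in> charts_at A p"
  using topspace_eq by (auto simp: charts_at_def)

lemma tangent_spaceI:
  assumes "\<And>c. c \<notin> charts_at A p \<Longrightarrow> v c = 0"
    and "\<And>c c'. c \<in> charts_at A p \<Longrightarrow> c' \<in> charts_at A p \<Longrightarrow> v c' = D c c' p (v c)"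
  shows "v \<in> tangent_space A p"
  unfolding tangent_space_def using assms by blast

lemma tangent_outside: "v \<in> tangent_space A p \<Longrightarrow> c \<notin> charts_at A p \<Longrightarrow> v c = 0"
  and tangent_transform: "v \<in> tangent_space A p \<Longrightarrow> c \<in> charts_at A p \<Longrightarrow> c' \<in> charts_at A p \<Longrightarrow>
    v c' = D c c' p (v c)"
  unfolding tangent_space_def by blast+

lemma subspace_tangent_space: "subspace (tangent_space A p)"
proof (rule subspaceI)
  show "0 \<in> tangent_space A p"
    by (rule tangent_spaceI) (simp_all add: linear_0[OF linear_D])
  show "u + v \<in> tangent_space A p" if "u \<in> tangent_space A p" "v \<in> tangent_space A p" for u v
  proof (rule tangent_spaceI)
    show "(u + v) c = 0" if "c \<notin> charts_at A p" for c
      using tangent_outside[OF \<open>u \<in> _\<close> that] tangent_outside[OF \<open>v \<in> _\<close> that] by simp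
    show "(u + v) c' = D c c' p ((u + v) c)" if "c \<in> charts_at A p" "c' \<in> charts_at A p" for c c'
      unfolding plus_fun_apply linear_add[OF linear_D[OF that]]
      using tangent_transform[OF \<open>u \<in> _\<close> that] tangent_transform[OF \<open>v \<in> _\<close> that] by metis
  qed
  show "r *\<^sub>R u \<in> tangent_space A p" if "u \<in> tangent_space A p" for r u
  proof (rule tangent_spaceI)
    show "(r *\<^sub>R u) c = 0" if "c \<notin> charts_at A p" for c
      using tangent_outside[OF \<open>u \<in> _\<close> that] by (simp add: scaleR_fun_def)
    show "(r *\<^sub>R u) c' = D c c' p ((r *\<^sub>R u) c)"
      if "c \<in> charts_at A p" "c' \<in> charts_at A p" for c c'
      unfolding scaleR_fun_def linear_scale[OF linear_D[OF that]]
      using tangent_transform[OF \<open>u \<in> _\<close> that] by metis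
  qed
qed

lemma tangent_eqI:
  assumes "u \<in> tangent_space A p" "v \<in> tangent_space A p" "c \<in> charts_at A p" "u c = v c"
  shows "u = v"
proof
  fix c'
  show "u c' = v c'"
    using assms tangent_outside tangent_transform by (cases "c' \<in> charts_at A p") metis+
qed

text \<open>The inverse of evaluation in the chart \<open>c\<close>: the tangent vector at
  \<open>p\<close> whose components in \<open>c\<close> are \<open>w\<close>.\<close>

definition tangent_of :: "('a, 'e) chart \<Rightarrow> 'a \<Rightarrow> 'e \<Rightarrow> ('a, 'e) tangent" where
  "tangent_of c p w = (\<lambda>c'. if c' \<in> charts_at A p then D c c' p w else 0)"

lemma tangent_of_in: "c \<in> charts_at A p \<Longrightarrow> tangent_of c p w \<in> tangent_space A p"
  by (rule tangent_spaceI) (simp_all add: tangent_of_def D_trans)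

lemma tangent_of_chart: "c \<in> charts_at A p \<Longrightarrow> tangent_of c p w c = w"
  by (simp add: tangent_of_def D_refl)

text \<open>Evaluation in one chart is injective on the tangent space by \<open>tangent_eqI\<close>
  and surjective by \<open>tangent_of\<close>, so it maps \<open>B\<close> to a basis of the
  Euclidean model space.\<close>

lemma basis_tangent_space:
  assumes "p \<in> topspace M" "independent B" "span B = tangent_space A p"
  shows "finite B" "card B = DIM('e)"
proof -
  obtain c where c: "c \<in> charts_at A p"
    using charts_at_nonempty[OF assms(1)] by blast
  let ?f = "\<lambda>v :: ('a, 'e) tangent. v c"
  have f: "linear ?f"
    by (rule linearI) (simp_all add: scaleR_fun_def)
  have inj: "inj_on ?f (span B)"
    using tangent_eqI[OF _ _ c] assms(3) by (auto intro: inj_onI)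
  have ind: "independent (?f ` B)"
    using linear_independent_injective_image[OF f assms(2) inj] .
  have "w \<in> ?f ` span B" for w
    using tangent_of_in[OF c] tangent_of_chart[OF c] assms(3)
    by (intro image_eqI[of _ _ "tangent_of c p w"]) simp_all
  then have "?f ` span B = UNIV"
    by blast
  then have "span (?f ` B) = UNIV"
    using linear_span_image[OF f] by simp
  then have "card (?f ` B) = DIM('e)"
    using ind dim_eq_card[of "?f ` B" UNIV] by simp
  moreover have injB: "inj_on ?f B"
    using inj inj_on_subset span_superset by blast
  moreover have "finite (?f ` B)"
    using ind by (rule independent_imp_finite)
  ultimately show "finite B" "card B = DIM('e)"
    by (simp_all add: finite_image_iff card_image)
qed

section \<open>Vector fields as a module over the smooth functions\<close>

lemma vector_fields_tangent: "X \<in> vector_fields A \<Longrightarrow> X p \<in> tangent_space A p"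
  and vector_fields_smooth:
    "X \<in> vector_fields A \<Longrightarrow> c \<in> A \<Longrightarrow> smooth_on (chart_img c) (\<lambda>x. X (chart_inv c x) c)"
  unfolding vector_fields_def by blast+

lemma vector_fieldsI:
  assumes "\<And>p. X p \<in> tangent_space A p"
    and "\<And>c. c \<in> A \<Longrightarrow> smooth_on (chart_img c) (\<lambda>x. X (chart_inv c x) c)"
  shows "X \<in> vector_fields A"
  unfolding vector_fields_def using assms by blast

lemma vector_fields_add:
  assumes "X \<in> vector_fields A" "Y \<in> vector_fields A"
  shows "X + Y \<in> vector_fields A"
  by (rule vector_fieldsI)
    (simp_all add: assms vector_fields_tangent vector_fields_smooth open_chart_img
      subspace_add[OF subspace_tangent_space] smooth_on_add)

lemma smooth_fun_chart:
  "smooth_fun A f \<Longrightarrow> c \<in> A \<Longrightarrow> smooth_on (chart_img c) (\<lambda>x. f (chart_inv c x))"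
  by (simp add: smooth_fun_def comp_def)

lemma vector_fields_scale:
  assumes "smooth_fun A f" "X \<in> vector_fields A"
  shows "scale_field f X \<in> vector_fields A"
proof (rule vector_fieldsI)
  show "scale_field f X p \<in> tangent_space A p" for p
    using assms(2)
    by (simp add: scale_field_def vector_fields_tangent subspace_scale[OF subspace_tangent_space])
  show "smooth_on (chart_img c) (\<lambda>x. scale_field f X (chart_inv c x) c)" if "c \<in> A" for c
    unfolding scale_field_def scaleR_fun_def
    using assms that by (intro smooth_on_scaleR open_chart_img smooth_fun_chart vector_fields_smooth)
qed

lemma smooth_fun_const: "smooth_fun A (\<lambda>p. r)"
  by (simp add: smooth_fun_def comp_def smooth_on_const)

lemma smooth_fun_mult: "smooth_fun A f \<Longrightarrow> smooth_fun A h \<Longrightarrow> smooth_fun A (\<lambda>p. f p * h p)"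
  by (simp add: smooth_fun_def comp_def smooth_on_mult open_chart_img)

lemma vector_fields_diff:
  assumes "X \<in> vector_fields A" "Y \<in> vector_fields A"
  shows "X - Y \<in> vector_fields A"
proof -
  have "X - Y = X + scale_field (\<lambda>p. - 1) Y"
    by (simp add: fun_eq_iff scale_field_def scaleR_fun_def)
  then show ?thesis
    using assms vector_fields_add vector_fields_scale[OF smooth_fun_const] by metis
qed

text \<open>The image of \<open>c'\<close> is covered by two open sets: the overlap with
  \<open>c\<close>, where \<open>h\<close> is smooth by assumption, and the part outside
  \<open>K\<close>, where \<open>h\<close> is zero. Since \<open>K\<close> lies inside the chart
  \<open>c\<close>, no point is missed.\<close>

lemma smooth_on_extend_zero:
  assumes c: "c \<in> A" "c' \<in> A" and K: "compact K" "K \<subseteq> chart_img c"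
    and smooth: "smooth_on (overlap c' c) h"
    and zero: "\<And>x. x \<in> chart_img c' \<Longrightarrow> chart_inv c' x \<notin> chart_inv c ` K \<Longrightarrow> h x = 0"
  shows "smooth_on (chart_img c') h"
proof -
  let ?U = "chart_map c' ` (chart_dom c' \<inter> (topspace M - chart_inv c ` K))"
  have U: "open ?U"
    using closedin_chart_preimage[OF c(1) K] by (intro open_chart_image c openin_diff) auto
  have "smooth_on ?U h"
    by (rule smooth_on_cong[OF U _ smooth_on_const[of _ 0]])
      (use zero c in \<open>auto simp: chart_map_in\<close>)
  then have "smooth_on (overlap c' c \<union> ?U) h"
    using smooth U open_overlap[OF c(2,1)] by (intro smooth_on_Un)
  moreover have "chart_inv c ` K \<subseteq> chart_dom c"
    using K(2) by (intro image_subsetI chart_inv_in) (rule subsetD)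
  then have "chart_dom c' = (chart_dom c' \<inter> chart_dom c) \<union> (chart_dom c' \<inter> (topspace M - chart_inv c ` K))"
    using chart_dom_subset[OF c(2)] by auto
  then have "chart_img c' = overlap c' c \<union> ?U"
    unfolding chart_img_def by (metis image_Un)
  ultimately show ?thesis by simp
qed

definition extend_fun :: "('a, 'e) chart \<Rightarrow> ('e \<Rightarrow> real) \<Rightarrow> 'a \<Rightarrow> real" where
  "extend_fun c f = (\<lambda>p. if p \<in> chart_dom c then f (chart_map c p) else 0)"

definition extend_field :: "('a, 'e) chart \<Rightarrow> ('e \<Rightarrow> 'e) \<Rightarrow> ('a, 'e) vfield" where
  "extend_field c F = (\<lambda>p. if p \<in> chart_dom c then tangent_of c p (F (chart_map c p)) else 0)"

lemma smooth_extend_fun: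
  assumes c: "c \<in> A" and f: "smooth_on (chart_img c) f"
    and K: "compact K" "K \<subseteq> chart_img c" and zero: "\<And>x. x \<notin> K \<Longrightarrow> f x = 0"
  shows "smooth_fun A (extend_fun c f)"
  unfolding smooth_fun_def
proof
  fix c' assume c': "c' \<in> A"
  show "smooth_on (chart_img c') (extend_fun c f \<circ> chart_inv c')"
  proof (rule smooth_on_extend_zero[OF c c' K])
    show "smooth_on (overlap c' c) (extend_fun c f \<circ> chart_inv c')"
    proof (rule smooth_on_cong[OF open_overlap[OF c' c]])
      show "f (transition c' c x) = (extend_fun c f \<circ> chart_inv c') x" if "x \<in> overlap c' c" for x
        using that c' by (auto simp: extend_fun_def)
      show "smooth_on (overlap c' c) (\<lambda>x. f (transition c' c x))"
        by (rule smooth_on_compose[OF open_overlap[OF c' c] f smooth_transition[OF c' c]])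
          (use c' in \<open>auto simp: chart_map_in\<close>)
    qed
    show "(extend_fun c f \<circ> chart_inv c') x = 0"
      if "x \<in> chart_img c'" "chart_inv c' x \<notin> chart_inv c ` K" for x
      using that zero c by (auto simp: extend_fun_def image_iff) (metis chart_inv_map)
  qed
qed

lemma extend_field_in:
  assumes c: "c \<in> A" and F: "smooth_on (chart_img c) F"
    and K: "compact K" "K \<subseteq> chart_img c" and zero: "\<And>x. x \<notin> K \<Longrightarrow> F x = 0"
  shows "extend_field c F \<in> vector_fields A"
proof -
  have "extend_field c F p \<in> tangent_space A p" for p
    using tangent_of_in[of c p] subspace_0[OF subspace_tangent_space] c
    by (auto simp: extend_field_def charts_at_def)
  moreover have "smooth_on (chart_img c') (\<lambda>x. extend_field c F (chart_inv c' x) c')"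
    (is "smooth_on _ ?h") if c': "c' \<in> A" for c'
  proof (rule smooth_on_extend_zero[OF c c' K])
    let ?t = "transition c' c"
    have t: "smooth_on (overlap c' c) ?t" "open (overlap c' c)" "?t ` overlap c' c \<subseteq> overlap c c'"
      using smooth_transition[OF c' c] open_overlap[OF c' c] c' by auto
    show "smooth_on (overlap c' c) ?h"
    proof (rule smooth_on_cong[OF t(2)])
      fix x assume x: "x \<in> overlap c' c"
      then obtain p where p: "x = chart_map c' p" "p \<in> chart_dom c" "p \<in> chart_dom c'"
        by auto
      have at: "c \<in> charts_at A p" "c' \<in> charts_at A p"
        using p c c' by (auto simp: charts_at_def)
      \<comment> \<open>The components in \<open>c'\<close> are the derivative of the coordinate
        change applied to \<open>F\<close>, a direction that varies with \<open>x\<close>; the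
        expansion along \<open>Basis\<close> exposes smooth factors.\<close>
      show "(\<Sum>b\<in>Basis. (F (?t x) \<bullet> b) *\<^sub>R frechet_derivative (transition c c') (at (?t x)) b) = ?h x"
        using frechet_derivative_euclidean[OF transition_differentiable[OF at], of "F (chart_map c p)"]
          p c c' at by (simp add: extend_field_def tangent_of_def)
    next
      have "smooth_on (overlap c' c) (\<lambda>x. F (?t x))"
        by (rule smooth_on_compose[OF t(2) F t(1)]) (use c' in \<open>auto simp: chart_map_in\<close>)
      moreover have "smooth_on (overlap c' c) (\<lambda>x. frechet_derivative (transition c c') (at (?t x)) b)" for b
        using smooth_on_compose[OF t(2) smooth_on_frechet_derivative[OF smooth_transition[OF c c']] t(1,3)] .
      ultimately show "smooth_on (overlap c' c) (\<lambda>x. \<Sum>b\<in>Basis. (F (?t x) \<bullet> b) *\<^sub>R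
          frechet_derivative (transition c c') (at (?t x)) b)"
        using t(2) by (intro smooth_on_sum smooth_on_scaleR smooth_on_inner smooth_on_const)
    qed
    show "?h x = 0" if "x \<in> chart_img c'" "chart_inv c' x \<notin> chart_inv c ` K" for x
    proof (cases "chart_inv c' x \<in> chart_dom c")
      case True
      then have "F (chart_map c (chart_inv c' x)) = 0"
        using that zero c by (metis chart_inv_map imageI)
      moreover have "c \<in> charts_at A (chart_inv c' x)"
        using True c by (simp add: charts_at_def)
      ultimately show ?thesis
        using linear_0[OF linear_D] by (simp add: extend_field_def tangent_of_def)
    qed (simp add: extend_field_def)
  qed
  ultimately show ?thesis by (rule vector_fieldsI)
qed

lemma extend_field_chart: "c \<in> charts_at A p \<Longrightarrow> extend_field c F p c = F (chart_map c p)"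
  by (simp add: extend_field_def tangent_of_chart charts_at_def)

lemma chart_bump:
  assumes "c \<in> charts_at A p"
  obtains b :: "'e \<Rightarrow> real" and K where "smooth_on (chart_img c) b" "b (chart_map c p) = 1"
    "compact K" "K \<subseteq> chart_img c" "\<And>x. x \<notin> K \<Longrightarrow> b x = 0"
proof -
  have c: "c \<in> A" "p \<in> chart_dom c"
    using assms by (auto simp: charts_at_def)
  obtain r where r: "r > 0" "cball (chart_map c p) r \<subseteq> chart_img c"
    using open_chart_img[OF c(1)] chart_map_in[OF c(2)] open_contains_cball by blast
  from r(1) obtain b :: "'e \<Rightarrow> real" where "\<And>S. open S \<Longrightarrow> smooth_on S b" "b (chart_map c p) = 1"
    "\<And>y. y \<notin> cball (chart_map c p) r \<Longrightarrow> b y = 0"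
    using smooth_bump by blast
  with that[of b "cball (chart_map c p) r"] r(2) open_chart_img[OF c(1)] show ?thesis by simp
qed

lemma vector_field_through:
  assumes "p \<in> topspace M" "v \<in> tangent_space A p"
  shows "\<exists>X\<in>vector_fields A. X p = v"
proof -
  obtain c where c: "c \<in> charts_at A p"
    using charts_at_nonempty[OF assms(1)] by blast
  then have cA: "c \<in> A" by (simp add: charts_at_def)
  obtain b :: "'e \<Rightarrow> real" and K where b: "smooth_on (chart_img c) b" "b (chart_map c p) = 1"
    "compact K" "K \<subseteq> chart_img c" "\<And>x. x \<notin> K \<Longrightarrow> b x = 0"
    using chart_bump[OF c] by blast
  let ?X = "extend_field c (\<lambda>x. b x *\<^sub>R v c)"
  have X: "?X \<in> vector_fields A"
    using b cA open_chart_img by (intro extend_field_in[of _ _ K] smooth_on_scaleR smooth_on_const) auto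
  moreover have "?X p = v"
    using tangent_eqI[OF vector_fields_tangent[OF X] assms(2) c] b(2) extend_field_chart[OF c] by simp
  ultimately show ?thesis by blast
qed

end

section \<open>Contraction of the soliton equation\<close>

lemma sum_fun_apply: "(\<Sum>i\<in>I. h i) x = (\<Sum>i\<in>I. h i x)"
  by (induction I rule: infinite_finite_induct) simp_all

locale riemannian = atlas M A
  for M :: "'a topology" and A :: "('a, 'e::euclidean_space) chart set" +
  fixes g :: "('a, 'e) metric" and nabla :: "('a, 'e) connection"
  assumes metric: "riemannian_metric A g" and levi_civita: "levi_civita M A g nabla"
begin

section \<open>Pointwise identities for the metric and its connection\<close>

lemma inner_product: "inner_product_within (tangent_space A p) (g p)"
  using metric subspace_tangent_space
  by unfold_locales (auto simp: riemannian_metric_def)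

lemma affine: "affine_connection A nabla"
  using levi_civita by (simp add: levi_civita_def)

lemma nabla_in: "X \<in> vector_fields A \<Longrightarrow> Y \<in> vector_fields A \<Longrightarrow> nabla X Y \<in> vector_fields A"
  and nabla_add: "X \<in> vector_fields A \<Longrightarrow> Y \<in> vector_fields A \<Longrightarrow> Z \<in> vector_fields A \<Longrightarrow>
    nabla (X + Z) Y = nabla X Y + nabla Z Y"
  and nabla_scale: "X \<in> vector_fields A \<Longrightarrow> Y \<in> vector_fields A \<Longrightarrow> smooth_fun A f \<Longrightarrow>
    nabla (scale_field f X) Y = scale_field f (nabla X Y)"
  and nabla_leibniz: "X \<in> vector_fields A \<Longrightarrow> Y \<in> vector_fields A \<Longrightarrow> smooth_fun A f \<Longrightarrow>
    nabla X (scale_field f Y) = scale_field f (nabla X Y) + scale_field (deriv_along A X f) Y"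
  using affine by (simp_all add: affine_connection_def)

lemma torsion_free:
  "X \<in> vector_fields A \<Longrightarrow> Y \<in> vector_fields A \<Longrightarrow> lie_bracket A X Y = nabla X Y - nabla Y X"
  using levi_civita by (simp add: levi_civita_def)

lemma lie_bracket_in:
  "X \<in> vector_fields A \<Longrightarrow> Y \<in> vector_fields A \<Longrightarrow> lie_bracket A X Y \<in> vector_fields A"
  by (simp add: torsion_free vector_fields_diff nabla_in)

lemma curvature_in:
  "X \<in> vector_fields A \<Longrightarrow> Y \<in> vector_fields A \<Longrightarrow> Z \<in> vector_fields A \<Longrightarrow>
    curvature A nabla X Y Z \<in> vector_fields A"
  unfolding curvature_def by (intro vector_fields_diff nabla_in lie_bracket_in)

text \<open>Metric compatibility expands the derivative of g(X,Y) along V, and vanishing torsion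
  rewrites the brackets [V,X] and [V,Y]. The derivatives in direction V cancel.\<close>

lemma lie_derivative_metric:
  assumes "V \<in> vector_fields A" "X \<in> vector_fields A" "Y \<in> vector_fields A" "p \<in> topspace M"
  shows "lie_derivative A V (metric_tensor g) X Y p
    = g p (nabla X V p) (Y p) + g p (X p) (nabla Y V p)"
proof -
  interpret inner_product_within "tangent_space A p" "g p" by (rule inner_product)
  have "deriv_along A V (\<lambda>q. g q (X q) (Y q)) p = g p (nabla V X p) (Y p) + g p (X p) (nabla V Y p)"
    using levi_civita assms by (simp add: levi_civita_def)
  moreover have "metric_tensor g X Y = (\<lambda>q. g q (X q) (Y q))"
    by (simp add: fun_eq_iff metric_tensor_def)
  ultimately show ?thesis
    using assms
    by (simp add: lie_derivative_def metric_tensor_def torsion_free diff_left diff_right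
        vector_fields_tangent nabla_in)
qed

section \<open>Dependence of the covariant derivative on its direction at a point\<close>

lemma nabla_sum:
  assumes "V \<in> vector_fields A" "\<And>i. i \<in> I \<Longrightarrow> X i \<in> vector_fields A"
  shows "(\<Sum>i\<in>I. X i) \<in> vector_fields A \<and> nabla (\<Sum>i\<in>I. X i) V = (\<Sum>i\<in>I. nabla (X i) V)"
proof -
  have "V - V \<in> vector_fields A"
    using assms(1) vector_fields_diff by blast
  then have 0: "0 \<in> vector_fields A" by simp
  then have "nabla 0 V = 0"
    using nabla_add[OF 0 assms(1) 0] by simp
  with 0 assms(2) show ?thesis
    by (induction I rule: infinite_finite_induct) (auto simp: nabla_add[OF _ assms(1)] vector_fields_add)
qed

text \<open>For a bump function \<open>b\<close> with \<open>b = 1\<close> at \<open>p\<close>, supported in a chart with coordinate fields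
  \<open>\<partial>\<^sub>i\<close>, the field \<open>b\<^sup>2 X\<close> is the sum of the globally defined fields \<open>(b X\<^sup>i) (b \<partial>\<^sub>i)\<close>.\<close>

lemma nabla_eq_0:
  assumes "X \<in> vector_fields A" "V \<in> vector_fields A" "p \<in> topspace M" "X p = 0"
  shows "nabla X V p = 0"
proof -
  obtain c where c: "c \<in> charts_at A p"
    using charts_at_nonempty[OF assms(3)] by blast
  then have cA: "c \<in> A" "p \<in> chart_dom c"
    by (auto simp: charts_at_def)
  obtain b :: "'e \<Rightarrow> real" and K where b: "smooth_on (chart_img c) b" "b (chart_map c p) = 1"
    "compact K" "K \<subseteq> chart_img c" "\<And>x. x \<notin> K \<Longrightarrow> b x = 0"
    using chart_bump[OF c] by blast
  let ?b = "extend_fun c b"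
  let ?f = "\<lambda>i. extend_fun c (\<lambda>x. b x * (X (chart_inv c x) c \<bullet> i))"
  let ?E = "\<lambda>i. extend_field c (\<lambda>x. b x *\<^sub>R i)"
  have E: "?E i \<in> vector_fields A" for i
    using b cA open_chart_img by (intro extend_field_in[of _ _ K] smooth_on_scaleR smooth_on_const) auto
  have f: "smooth_fun A (?f i)" for i
    using b cA open_chart_img vector_fields_smooth[OF assms(1)]
    by (intro smooth_extend_fun[of _ _ K] smooth_on_mult smooth_on_inner smooth_on_const) auto
  have bb: "smooth_fun A (\<lambda>q. ?b q * ?b q)"
    using b cA by (intro smooth_fun_mult smooth_extend_fun[of _ _ K]) auto
  have fE: "scale_field (?f i) (?E i) \<in> vector_fields A" for i
    using E f vector_fields_scale by blast
  have eq: "scale_field (\<lambda>q. ?b q * ?b q) X = (\<Sum>i\<in>Basis. scale_field (?f i) (?E i))"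
  proof
    fix q
    show "scale_field (\<lambda>q. ?b q * ?b q) X q = (\<Sum>i\<in>Basis. scale_field (?f i) (?E i)) q"
    proof (cases "q \<in> chart_dom c")
      case True
      then have cq: "c \<in> charts_at A q"
        using cA by (simp add: charts_at_def)
      let ?r = "b (chart_map c q)"
      have "scale_field (\<lambda>q. ?b q * ?b q) X q c = (?r * ?r) *\<^sub>R X q c"
        using True by (simp add: scale_field_def scaleR_fun_def extend_fun_def)
      also have "\<dots> = (?r * ?r) *\<^sub>R (\<Sum>i\<in>Basis. (X q c \<bullet> i) *\<^sub>R i)"
        by (simp only: euclidean_representation)
      also have "\<dots> = (\<Sum>i\<in>Basis. (?r * (X q c \<bullet> i)) *\<^sub>R ?r *\<^sub>R i)"
        by (simp add: scaleR_sum_right ac_simps)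
      also have "\<dots> = (\<Sum>i\<in>Basis. scale_field (?f i) (?E i)) q c"
        using True cA
        by (simp add: sum_fun_apply scale_field_def scaleR_fun_def extend_fun_def extend_field_chart[OF cq])
      finally show ?thesis
        using vector_fields_tangent[OF vector_fields_scale[OF bb assms(1)]]
          vector_fields_tangent[OF conjunct1[OF nabla_sum[OF assms(2) fE]]]
        by (intro tangent_eqI[OF _ _ cq])
    qed (simp add: sum_fun_apply scale_field_def extend_fun_def)
  qed
  \<comment> \<open>Since \<open>b\<close> is 1 at \<open>p\<close>, multiplying by its square
    leaves the value there unchanged.\<close>
  have "nabla X V p = nabla (scale_field (\<lambda>q. ?b q * ?b q) X) V p"
    using nabla_scale[OF assms(1,2) bb] b(2) cA by (simp add: scale_field_def extend_fun_def)
  also have "\<dots> = (\<Sum>i\<in>Basis. nabla (scale_field (?f i) (?E i)) V p)"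
    using nabla_sum[OF assms(2) fE, of "\<lambda>i. i" Basis] by (simp add: eq sum_fun_apply)
  \<comment> \<open>Linearity over functions pulls out the coefficients, and these vanish at
    \<open>p\<close> together with \<open>X\<close>.\<close>
  also have "\<dots> = 0"
    unfolding nabla_scale[OF E assms(2) f] using assms(4) cA by (simp add: scale_field_def extend_fun_def)
  finally show ?thesis .
qed

lemma nabla_cong:
  assumes "X \<in> vector_fields A" "Y \<in> vector_fields A" "V \<in> vector_fields A" "p \<in> topspace M"
    and "X p = Y p"
  shows "nabla X V p = nabla Y V p"
proof -
  have XY: "X - Y \<in> vector_fields A"
    using assms vector_fields_diff by blast
  then have "nabla X V = nabla (X - Y) V + nabla Y V"
    using nabla_add[OF XY assms(3,2)] by simp
  then show ?thesis
    using nabla_eq_0[OF XY assms(3,4)] assms(5) by simp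
qed

text \<open>The same choice expression as in \<open>field_trace\<close>, so that unfolding a trace
  produces \<open>field_at\<close> literally.\<close>

definition field_at :: "'a \<Rightarrow> ('a, 'e) tangent \<Rightarrow> ('a, 'e) vfield" where
  "field_at p v = (SOME X. X \<in> vector_fields A \<and> X p = v)"

lemma field_at:
  assumes "p \<in> topspace M" "v \<in> tangent_space A p"
  shows "field_at p v \<in> vector_fields A" "field_at p v p = v"
  unfolding field_at_def
  using someI_ex[of "\<lambda>X. X \<in> vector_fields A \<and> X p = v"] vector_field_through[OF assms] by blast+

text \<open>The endomorphism of the tangent space at \<open>p\<close> whose trace is the divergence
  of \<open>V\<close>.\<close>

definition nabla_at :: "('a, 'e) vfield \<Rightarrow> 'a \<Rightarrow> ('a, 'e) tangent \<Rightarrow> ('a, 'e) tangent" where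
  "nabla_at V p v = nabla (field_at p v) V p"

lemma nabla_at_eq:
  assumes "X \<in> vector_fields A" "V \<in> vector_fields A" "p \<in> topspace M"
  shows "nabla X V p = nabla_at V p (X p)"
  unfolding nabla_at_def using assms
  by (intro nabla_cong) (simp_all add: field_at vector_fields_tangent)

lemma nabla_at_in:
  assumes "V \<in> vector_fields A" "p \<in> topspace M" "v \<in> tangent_space A p"
  shows "nabla_at V p v \<in> tangent_space A p"
  using assms by (simp add: nabla_at_def vector_fields_tangent nabla_in field_at)

lemma linear_nabla_at:
  assumes V: "V \<in> vector_fields A" and p: "p \<in> topspace M"
  shows "linear_within (tangent_space A p) (nabla_at V p)"
  unfolding linear_within_def
proof (intro conjI ballI allI)
  fix u assume u: "u \<in> tangent_space A p"
  note X = field_at[OF p u]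
  show "nabla_at V p (u + v) = nabla_at V p u + nabla_at V p v" if v: "v \<in> tangent_space A p" for v
  proof -
    note Y = field_at[OF p v]
    show ?thesis
      using nabla_at_eq[OF vector_fields_add[OF X(1) Y(1)] V p] nabla_at_eq[OF X(1) V p]
        nabla_at_eq[OF Y(1) V p] nabla_add[OF X(1) V Y(1)] X Y by simp
  qed
  show "nabla_at V p (r *\<^sub>R u) = r *\<^sub>R nabla_at V p u" for r
    using nabla_at_eq[OF vector_fields_scale[OF smooth_fun_const X(1)] V p, of r]
      nabla_at_eq[OF X(1) V p] nabla_scale[OF X(1) V smooth_fun_const, of r] X
    by (simp add: scale_field_def)
qed

text \<open>The choice inside \<open>trace_on\<close> depends on the tangent space alone. One basis
  \<open>B\<close> therefore evaluates the divergence and the Ricci tensor at \<open>p\<close>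
  simultaneously.\<close>

lemma trace_on_dual_bases:
  assumes "p \<in> topspace M"
  obtains B d where "dual_bases (tangent_space A p) (g p) B d" "card B = DIM('e)"
    "\<And>L. (\<And>v. v \<in> tangent_space A p \<Longrightarrow> L v \<in> tangent_space A p) \<Longrightarrow>
      trace_on (tangent_space A p) L = (\<Sum>b\<in>B. g p (L b) (d b))"
proof -
  let ?T = "tangent_space A p"
  interpret inner_product_within ?T "g p" by (rule inner_product)
  define B where "B = (SOME B. independent B \<and> span B = ?T)"
  obtain B' where "B' \<subseteq> ?T" "independent B'" "?T \<subseteq> span B'"
    using maximal_independent_subset by blast
  then have "independent B' \<and> span B' = ?T"
    using span_minimal[OF _ subspace] by blast
  then have B: "independent B" "span B = ?T"
    unfolding B_def by (metis (mono_tags, lifting) someI_ex)+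
  note card = basis_tangent_space[OF assms B]
  obtain d where "dual_bases ?T (g p) B d"
    using dual_basis_exists[OF card(1) B] by blast
  then interpret dual_bases ?T "g p" B d .
  have "trace_on ?T L = (\<Sum>b\<in>B. g p (L b) (d b))" if "\<And>v. v \<in> ?T \<Longrightarrow> L v \<in> ?T" for L
    using that B_in by (simp add: trace_on_def Let_def B_def[symmetric] representation_eq)
  with \<open>dual_bases ?T (g p) B d\<close> card that show ?thesis by blast
qed

text \<open>In the contraction the four terms of h and g contribute tr h = 0, n h(Y,Z) and twice
  -h(Y,Z), while G contributes (n - 1) g(Y,Z). This is the origin of the factors n - 2 and n -
  1.\<close>

lemma contract_soliton:
  assumes soliton: "almost_riemann_soliton M A g nabla V l" and solenoidal: "solenoidal M A nabla V"
    and Y: "Y \<in> vector_fields A" and Z: "Z \<in> vector_fields A" and p: "p \<in> topspace M"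
  shows "(real DIM('e) - 2) * (1/2 * lie_derivative A V (metric_tensor g) Y Z p)
    + ricci_tensor A nabla Y Z p = (real DIM('e) - 1) * l p * metric_tensor g Y Z p"
proof -
  let ?T = "tangent_space A p"
  obtain B d where "dual_bases ?T (g p) B d" and card: "card B = DIM('e)"
    and trace: "\<And>L. (\<And>v. v \<in> ?T \<Longrightarrow> L v \<in> ?T) \<Longrightarrow>
      trace_on ?T L = (\<Sum>b\<in>B. g p (L b) (d b))"
    using trace_on_dual_bases[OF p] by blast
  then interpret dual_bases ?T "g p" B d by blast
  have V: "V \<in> vector_fields A"
    using soliton by (simp add: almost_riemann_soliton_def soliton_data_def)
  define N where "N = nabla_at V p"
  have N: "linear_within ?T N" "\<And>v. v \<in> ?T \<Longrightarrow> N v \<in> ?T"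
    using linear_nabla_at[OF V p] nabla_at_in[OF V p] by (auto simp: N_def)
  define h where "h u v = 1/2 * (g p (N u) v + g p u (N v))" for u v
  have lie: "1/2 * lie_derivative A V (metric_tensor g) X W p = h (X p) (W p)"
    if "X \<in> vector_fields A" "W \<in> vector_fields A" for X W
    using lie_derivative_metric[OF V that p] that V p by (simp add: h_def N_def nabla_at_eq)
  let ?y = "Y p" and ?z = "Z p"
  have yz: "?y \<in> ?T" "?z \<in> ?T"
    using Y Z vector_fields_tangent by blast+
  have hz: "linear_within ?T (\<lambda>u. h u ?z)" and hy: "linear_within ?T (h ?y)"
    using linear_within_scaled_sum[OF linear_within_compose[OF N linear_left] linear_left, of ?z "N ?z" "1/2"]
      linear_within_scaled_sum[OF linear_right linear_within_compose[OF N linear_right], of "N ?y" ?y "1/2"]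
      yz N(2) by (simp_all add: h_def[abs_def])
  have "(\<Sum>b\<in>B. g p (N b) (d b)) = 0"
    using solenoidal p trace[of N] N(2)
    by (simp add: solenoidal_def divergence_def field_trace_def N_def nabla_at_def[abs_def] field_at_def)
  \<comment> \<open>The trace of h is the mean of the traces of \<open>N\<close> and of its adjoint,
    and both equal the divergence.\<close>
  then have tr_h: "(\<Sum>b\<in>B. h b (d b)) = 0"
    using trace_dual[OF N] by (simp add: h_def sum.distrib flip: sum_divide_distrib)
  have R: "riemann_tensor A g nabla (field_at p b) Y Z (field_at p (d b)) p
    = l p * (g p b (d b) * g p ?y ?z - g p b ?z * g p ?y (d b))
      - (h b (d b) * g p ?y ?z + h ?y ?z * g p b (d b) - h b ?z * g p ?y (d b) - h ?y (d b) * g p b ?z)"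
    if "b \<in> B" for b
  proof -
    let ?X = "field_at p b" and ?W = "field_at p (d b)"
    have X: "?X \<in> vector_fields A" "?X p = b" and W: "?W \<in> vector_fields A" "?W p = d b"
      using field_at[OF p] B_in dual_in that by auto
    have "1/2 * (lie_derivative A V (metric_tensor g) \<odot>\<^sub>K\<^sub>N metric_tensor g) ?X Y Z ?W p
          + riemann_tensor A g nabla ?X Y Z ?W p = l p * G_tensor g ?X Y Z ?W p"
      using soliton X W Y Z p by (simp add: almost_riemann_soliton_def)
    moreover have "1/2 * (lie_derivative A V (metric_tensor g) \<odot>\<^sub>K\<^sub>N metric_tensor g) ?X Y Z ?W p
      = h b (d b) * g p ?y ?z + h ?y ?z * g p b (d b) - h b ?z * g p ?y (d b) - h ?y (d b) * g p b ?z"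
      using lie[OF X(1) W(1)] lie[OF Y Z] lie[OF X(1) Z] lie[OF Y W(1)]
      by (simp add: kulkarni_nomizu_def metric_tensor_def X W flip: lie)
    moreover have "G_tensor g ?X Y Z ?W p = g p b (d b) * g p ?y ?z - g p b ?z * g p ?y (d b)"
      by (simp add: G_tensor_def kulkarni_nomizu_def metric_tensor_def X W)
    ultimately show ?thesis by (metis add_diff_cancel_left')
  qed
  have "curvature A nabla (field_at p v) Y Z p \<in> ?T" if "v \<in> ?T" for v
    using that Y Z p by (simp add: vector_fields_tangent curvature_in field_at)
  then have "ricci_tensor A nabla Y Z p
      = (\<Sum>b\<in>B. g p (curvature A nabla (field_at p b) Y Z p) (d b))"
    using trace[of "\<lambda>v. curvature A nabla (field_at p v) Y Z p"]
    by (simp add: ricci_tensor_def field_trace_def field_at_def)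
  also have "\<dots> = (\<Sum>b\<in>B. riemann_tensor A g nabla (field_at p b) Y Z (field_at p (d b)) p)"
    using field_at[OF p dual_in] by (simp add: riemann_tensor_def)
  also have "\<dots> = l p * ((\<Sum>b\<in>B. g p b (d b)) * g p ?y ?z - (\<Sum>b\<in>B. g p b ?z * g p ?y (d b)))
      - ((\<Sum>b\<in>B. h b (d b)) * g p ?y ?z + h ?y ?z * (\<Sum>b\<in>B. g p b (d b))
        - (\<Sum>b\<in>B. h b ?z * g p ?y (d b)) - (\<Sum>b\<in>B. h ?y (d b) * g p b ?z))"
    by (simp add: R sum_subtractf sum.distrib flip: sum_distrib_left sum_distrib_right)
  \<comment> \<open>Each \<open>g p b (d b)\<close> is 1, so these sum to the size of the basis. The
    mixed sums collapse by \<open>contract_B\<close> when \<open>Y\<close> meets a dual vector and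
    by \<open>contract_dual\<close> when \<open>Z\<close> meets a basis vector.\<close>
  also have "\<dots> = l p * (real DIM('e) * g p ?y ?z - g p ?y ?z)
      - (h ?y ?z * real DIM('e) - h ?y ?z - h ?y ?z)"
    using tr_h card contract_B[OF linear_left yz(1), of ?z] contract_B[OF hz yz(1)]
      contract_dual[OF hy yz(2)] yz by (simp add: dual)
  finally show ?thesis
    using lie[OF Y Z] by (simp add: metric_tensor_def algebra_simps)
qed

section \<open>Constant multiples of the soliton field\<close>

lemma deriv_along_const: "deriv_along A X (\<lambda>p. r) = (\<lambda>p. 0)"
  by (rule ext) (simp add: deriv_along_def Let_def comp_def)

text \<open>For a constant factor the derivative term in the Leibniz rule vanishes, so the covariant
  derivative of the field is simply multiplied by \<open>r\<close>.\<close>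

lemma lie_derivative_scale:
  assumes "V \<in> vector_fields A" "X \<in> vector_fields A" "Y \<in> vector_fields A" "p \<in> topspace M"
  shows "lie_derivative A (\<lambda>q. r *\<^sub>R V q) (metric_tensor g) X Y p
    = r * lie_derivative A V (metric_tensor g) X Y p"
proof -
  interpret inner_product_within "tangent_space A p" "g p" by (rule inner_product)
  have rV: "(\<lambda>q. r *\<^sub>R V q) = scale_field (\<lambda>q. r) V"
    by (simp add: scale_field_def)
  have "nabla W (\<lambda>q. r *\<^sub>R V q) p = r *\<^sub>R nabla W V p" if "W \<in> vector_fields A" for W
    unfolding rV using nabla_leibniz[OF that assms(1) smooth_fun_const, of r]
    by (simp add: deriv_along_const scale_field_def)
  moreover have "(\<lambda>q. r *\<^sub>R V q) \<in> vector_fields A"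
    unfolding rV using assms(1) by (intro vector_fields_scale smooth_fun_const)
  ultimately show ?thesis
    using assms
    by (simp add: lie_derivative_metric scale_left linear_within_scaleR[OF linear_right]
        vector_fields_tangent nabla_in algebra_simps)
qed

end

theorem proposition2p2:
  fixes M :: "'a topology"
    and A :: "('a, 'e::euclidean_space) chart set"
    and g :: "('a, 'e) metric"
    and nabla :: "('a, 'e) connection"
    and V :: "('a, 'e) vfield"
    and l :: "'a \<Rightarrow> real"
    and n :: nat
  assumes dim: "n = DIM('e)" and n: "n \<ge> 3"
    and manifold: "riemannian_manifold M A g"
    and connection: "levi_civita M A g nabla"
    and soliton: "almost_riemann_soliton M A g nabla V l"
    and solenoidal: "solenoidal M A nabla V"
  shows "almost_alpha_ricci_soliton (1 / (real n - 2)) M A g nabla V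
           (\<lambda>p. (real n - 1) / (real n - 2) * l p)
       \<and> almost_ricci_soliton M A g nabla (\<lambda>p. (real n - 2) *\<^sub>R V p)
           (\<lambda>p. (real n - 1) * l p)"
proof -
  interpret riemannian M A g nabla
    using manifold connection by unfold_locales (auto simp: riemannian_manifold_def)
  have data: "V \<in> vector_fields A" "\<forall>p\<in>topspace M. V p \<noteq> 0" "smooth_fun A l"
    using soliton by (auto simp: almost_riemann_soliton_def soliton_data_def)
  have n2: "real n - 2 > 0"
    using n by linarith
  have key: "(real n - 2) * (1/2 * lie_derivative A V (metric_tensor g) X Y p)
      + ricci_tensor A nabla X Y p = (real n - 1) * l p * metric_tensor g X Y p"
    if "X \<in> vector_fields A" "Y \<in> vector_fields A" "p \<in> topspace M" for X Y p
    using contract_soliton[OF soliton solenoidal that] by (simp add: dim)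
  have l: "smooth_fun A (\<lambda>p. r * l p)" for r
    using data(3) by (intro smooth_fun_mult smooth_fun_const)
  have "(\<lambda>p. (real n - 2) *\<^sub>R V p) \<in> vector_fields A"
    using vector_fields_scale[OF smooth_fun_const data(1)] by (simp add: scale_field_def)
  \<comment> \<open>The scaling multiplies the Lie derivative by n - 2, which turns
    \<open>key\<close> into the required equation. Positivity of n - 2 keeps the scaled field
    non-vanishing.\<close>
  then have "almost_ricci_soliton M A g nabla (\<lambda>p. (real n - 2) *\<^sub>R V p) (\<lambda>p. (real n - 1) * l p)"
    using data l n2 key
    by (auto simp: almost_ricci_soliton_def soliton_data_def lie_derivative_scale)
  moreover have "1/2 * lie_derivative A V (metric_tensor g) X Y p
      + 1 / (real n - 2) * ricci_tensor A nabla X Y p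
      = (real n - 1) / (real n - 2) * l p * metric_tensor g X Y p"
    if "X \<in> vector_fields A" "Y \<in> vector_fields A" "p \<in> topspace M" for X Y p
  proof -
    \<comment> \<open>Dividing \<open>key\<close> by n - 2 produces both the coefficient of Ric and
      the new soliton function.\<close>
    have "h + 1 / (real n - 2) * r = k / (real n - 2)" if "(real n - 2) * h + r = k" for h r k
      using n2 that by (simp add: field_simps)
    from this[OF key[OF that]] show ?thesis by simp
  qed
  then have "almost_alpha_ricci_soliton (1 / (real n - 2)) M A g nabla V
      (\<lambda>p. (real n - 1) / (real n - 2) * l p)"
    using data l[of "(real n - 1) / (real n - 2)"]
    by (auto simp: almost_alpha_ricci_soliton_def soliton_data_def)
  ultimately show ?thesis by blast
qed

end
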